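(* Let $\mathcal{E}$ be a consumption-loan overlapping generations economy (as described in the context) such that: $\mathcal{E}$ has bounded intraperiod growth rates with constants $0<\alpha_{\min}<\alpha_{\max}$; for every $j\ge0$, all households in $\bigcup_{t=0}^jG_t$ are indirectly resource related to one another; $\mathcal{E}$ has unbounded aggregate demand at border prices with constants $\sigma_t\in(0,1)$, $t\ge0$; $\mathcal{E}$ satisfies the generalized Cass criterion; $\mathcal{E}$ is prone to savings with constants $\varepsilon>0$, $\delta>0$; and $\inf_{t\ge0}\sigma_t>0$, $\sup_{t\ge0}L_t<\infty$. Then the subset of Pareto optimal equilibria $\mathcal{H}^{PO}\subseteq\mathcal{H}$ is non-empty and compact (in the product topology of $\mathbb{R}^\infty$), and for every $p\in\mathcal{H}^{PO}$, $$\frac{\sum_{h\in G_0}s^h(p_0,p_1)}{\sum_{h\in G_0}\Vert e^h_0\Vert}>\delta.$$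
   Context: Notation: $\Vert c\Vert=\sum_i|c_i|$; $\mathbb{R}_+^n$, $\mathbb{R}_{++}^n$ are the vectors with non-negative, resp. strictly positive, coordinates; $\mathbb{R}^\infty$ carries the product topology, and its elements are written $p=(p_0,p_1,\ldots)$ with $p_t\in\mathbb{R}^{L_t}$, $p_t=(p_{t1},\ldots,p_{tL_t})$. Vectors in $\mathbb{R}^{L_t+L_{t+1}}$ are regarded as elements of the space of all commodities by placing them in the coordinates of periods $t,t+1$ and $0$ elsewhere. Economy $\mathcal{E}$: time is $t\in\{0,1,2,\ldots\}$, with $L_t\ge1$ perishable commodities in period $t$. Households are indexed by $h\in\mathbb{N}$; $G_t$ is the (finite, non-empty) set of households born in period $t\ge0$; each lives in periods $t$ and $t+1$. Household $h\in G_t$ has consumption set $\mathbb{R}^{L_t+L_{t+1}}_+$, a nonzero endowment $e^h=(e^h_t,e^h_{t+1})\in\mathbb{R}^{L_t+L_{t+1}}_+$ and a utility function $u^h:\mathbb{R}^{L_t+L_{t+1}}_+\to\mathbb{R}$ that is continuous, non-decreasing, without local maxima and semi-strictly quasiconcave (i.e. $u(\tilde c)\ge u(c)$ implies $u(\alpha\tilde c+(1-\alpha)c)\ge u(c)$ for $0\le\alpha\le1$, and $u(\tilde c)>u(c)$ implies $u(\alpha\tilde c+(1-\alpha)c)>u(c)$ for $0<\alpha\le1$). Also $\sum_{t\ge0}\sum_{h\in G_t}e^h\in\mathbb{R}^\infty_{++}$. Demand: for $h\in G_t$ and $(p_t,p_{t+1})\in\mathbb{R}^{L_t+L_{t+1}}_{++}$,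 $x^h(p_t,p_{t+1})=(x^h_t,x^h_{t+1})(p_t,p_{t+1})$ is the maximizer of $u^h(c)$ over $c\in\mathbb{R}_+^{L_t+L_{t+1}}$ with $(p_t,p_{t+1})\cdot(c-e^h)\le0$; it is assumed to be single-valued, so $x^h$ is a function. Excess demand in period $t\ge1$ is $$z_t(p_{t-1},p_t,p_{t+1})=\sum_{h\in G_{t-1}}(x^h_t(p_{t-1},p_t)-e^h_t)+\sum_{h\in G_t}(x^h_t(p_t,p_{t+1})-e^h_t).$$ Real savings of $h\in G_t$: $s^h(p_t,p_{t+1})=\frac{p_t}{\Vert p_t\Vert}\cdot(e^h_t-x^h_t(p_t,p_{t+1}))$. Bounded intraperiod growth rates: there are $0<\alpha_{\min}<\alpha_{\max}$ such that $\alpha_t=\sum_{h\in G_{t+1}}\Vert e^h_{t+1}\Vert/\sum_{h\in G_t}\Vert e^h_{t+1}\Vert\in(\alpha_{\min},\alpha_{\max})$ for all $t\ge0$. Put $\beta=\max\{1+\alpha_{\min}^{-1},1+\alpha_{\max}\}$. Resource relatedness: fix $j\ge0$. Household $h'\in\bigcup_{t=0}^jG_t$ is resource related to $h''\in\bigcup_{t=0}^jG_t$ if for every allocation $\{c^h\}_{h\in\bigcup_{t=0}^jG_t}$, $c^h\in\mathbb{R}^{L_t+L_{t+1}}_+$ for $h\in G_t$, with $\sum_{t\le j}\sum_{h\in G_t}c^h\le\sum_{t\le j}\sum_{h\in G_t}e^h$, there are an allocation $\{\tilde c^h\}$ of the same type and $y\in\mathbb{R}_+^{\sum_{i=0}^{j+1}L_i}$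 such that $\sum_{t\le j}\sum_{h\in G_t}\tilde c^h\le\sum_{t\le j}\sum_{h\in G_t}e^h+y$, $u^h(\tilde c^h)\ge u^h(c^h)$ for all $h$, $u^{h''}(\tilde c^{h''})>u^{h''}(c^{h''})$, and $y_{ti}>0$ only if $e^{h'}_{ti}>0$ (for $1\le i\le L_t$, $0\le t\le j+1$). $h'$ is indirectly resource related to $h''$ if there is a finite chain $h_0=h',h_1,\ldots,h_n=h''$, $n\ge1$, in $\bigcup_{t=0}^jG_t$ with $h_m$ resource related to $h_{m+1}$ for $0\le m\le n-1$. Unbounded aggregate demand at border prices: with $\mathcal{B}_t(\sigma)=\{p\in\mathbb{R}^{L_t+L_{t+1}}_{++}\mid\sigma\le p_i\le\sigma^{-1},\ 1\le i\le L_t+L_{t+1}\}$, for all $t\ge0$ there is $\sigma_t\in(0,1)$ (fixed from now on) such that for all $(p_t,p_{t+1})\in\mathbb{R}^{L_t+L_{t+1}}_{++}$, if $(p_t/p_{t1},p_{t+1}/p_{t1})\notin\mathcal{B}_t(\sigma_t)$ then $\sum_{h\in G_t}\Vert x^h(p_t,p_{t+1})\Vert>\beta\sum_{h\in G_t}\Vert e^h\Vert$. Set of equilibria: $\mathcal{H}=\{p\in\mathbb{R}^{\infty}_{++}\mid p_{01}=1,\ (p_0,p_1)\in\mathcal{B}_0(\sigma_0),\ z_t(p_{t-1},p_t,p_{t+1})=0\ \forall t\ge1\}$. Subset of Pareto optimal equilibria: $\mathcal{H}^{PO}$ is the set of $p\in\mathcal{H}$ for which there is no family $\{y^h\}$,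 $y^h\in\mathbb{R}^{L_t+L_{t+1}}_+$ for $h\in G_t$, $t\ge0$, with $\sum_{t\ge0}\sum_{h\in G_t}(y^h-x^h(p_t,p_{t+1}))=0$ and $u^h(y^h)\ge u^h(x^h(p_t,p_{t+1}))$ for all $h\in G_t$, $t\ge0$, with at least one strict inequality. Generalized Cass criterion (an assumption on $\mathcal{E}$): for every $p\in\mathcal{H}$, $p\in\mathcal{H}^{PO}$ if and only if $\sum_{t=0}^{\infty}\frac{1}{\Vert p_t\Vert\sum_{h\in G_t}\Vert e^h_t\Vert}=+\infty$. Prone to savings with constants $\varepsilon,\delta>0$: for all $t\ge0$ and $(p_t,p_{t+1})\in\mathbb{R}^{L_t+L_{t+1}}_{++}$ with $(p_t/p_{t1},p_{t+1}/p_{t1})\in\mathcal{B}_t(\sigma_t)$, $$\frac{\sum_{h\in G_t}s^h(p_t,p_{t+1})}{\sum_{h\in G_t}\Vert e^h_t\Vert}\le\delta\implies\frac{\Vert p_t\Vert}{\Vert p_{t+1}\Vert}\le\frac{1}{1+\varepsilon}\,\frac{\sum_{h\in G_{t+1}}\Vert e^h_{t+1}\Vert}{\sum_{h\in G_t}\Vert e^h_t\Vert}.$$ *)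

theory Defs
  imports "HOL-Analysis.Analysis"
begin

text \<open>
  A commodity is a pair of a period \<open>t\<close> and an index \<open>i < ncom E t\<close>; indices start at \<open>0\<close>, so the
  numeraire of period \<open>t\<close> has index \<open>0\<close>.  A vector of one period is a function
  \<^typ>\<open>nat \<Rightarrow> real\<close>, a bundle or a price system a function \<^typ>\<open>nat \<Rightarrow> nat \<Rightarrow> real\<close>, and both
  vanish at indices which are not commodities.  Under this embedding the topology of the function
  type induces on price systems the product topology, and on consumption sets the Euclidean one.
\<close>

record economy =
  ncom :: "nat \<Rightarrow> nat"
  gen :: "nat \<Rightarrow> nat set"
  endow :: "nat \<Rightarrow> nat \<Rightarrow> nat \<Rightarrow> real"
  util :: "nat \<Rightarrow> (nat \<Rightarrow> nat \<Rightarrow> real) \<Rightarrow> real"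

definition norm1 :: "nat \<Rightarrow> (nat \<Rightarrow> real) \<Rightarrow> real" where
  "norm1 n v = (\<Sum>i<n. \<bar>v i\<bar>)"

definition pos_vec :: "nat \<Rightarrow> (nat \<Rightarrow> real) set" where
  "pos_vec n = {v. (\<forall>i<n. 0 < v i) \<and> (\<forall>i\<ge>n. v i = 0)}"

definition cons_set :: "economy \<Rightarrow> nat \<Rightarrow> (nat \<Rightarrow> nat \<Rightarrow> real) set" where
  "cons_set E t = {c. (\<forall>s i. 0 \<le> c s i) \<and>
     (\<forall>s i. \<not> (s \<in> {t, Suc t} \<and> i < ncom E s) \<longrightarrow> c s i = 0)}"

definition bundle_norm :: "economy \<Rightarrow> nat \<Rightarrow> (nat \<Rightarrow> nat \<Rightarrow> real) \<Rightarrow> real" where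
  "bundle_norm E t c = norm1 (ncom E t) (c t) + norm1 (ncom E (Suc t)) (c (Suc t))"

definition nondecreasing_on ::
    "(nat \<Rightarrow> nat \<Rightarrow> real) set \<Rightarrow> ((nat \<Rightarrow> nat \<Rightarrow> real) \<Rightarrow> real) \<Rightarrow> bool" where
  "nondecreasing_on X f \<longleftrightarrow> (\<forall>c\<in>X. \<forall>c'\<in>X. (\<forall>s i. c s i \<le> c' s i) \<longrightarrow> f c \<le> f c')"

definition no_local_max_on ::
    "(nat \<Rightarrow> nat \<Rightarrow> real) set \<Rightarrow> ((nat \<Rightarrow> nat \<Rightarrow> real) \<Rightarrow> real) \<Rightarrow> bool" where
  "no_local_max_on X f \<longleftrightarrow>
     (\<forall>c\<in>X. \<forall>U. open U \<and> c \<in> U \<longrightarrow> (\<exists>c'\<in>U \<inter> X. f c < f c'))"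

definition semistrictly_quasiconcave_on ::
    "(nat \<Rightarrow> nat \<Rightarrow> real) set \<Rightarrow> ((nat \<Rightarrow> nat \<Rightarrow> real) \<Rightarrow> real) \<Rightarrow> bool" where
  "semistrictly_quasiconcave_on X f \<longleftrightarrow> (\<forall>c\<in>X. \<forall>c'\<in>X.
     (f c \<le> f c' \<longrightarrow>
       (\<forall>a. 0 \<le> a \<and> a \<le> 1 \<longrightarrow> f c \<le> f (\<lambda>s i. a * c' s i + (1 - a) * c s i))) \<and>
     (f c < f c' \<longrightarrow>
       (\<forall>a. 0 < a \<and> a \<le> 1 \<longrightarrow> f c < f (\<lambda>s i. a * c' s i + (1 - a) * c s i))))"

text \<open>In the following \<open>t\<close> is the birth period of the household \<open>h\<close>, and \<open>p\<close>, \<open>q\<close> are the prices of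
  the periods \<open>t\<close> and \<open>t + 1\<close>.\<close>

definition budget_set ::
    "economy \<Rightarrow> nat \<Rightarrow> nat \<Rightarrow> (nat \<Rightarrow> real) \<Rightarrow> (nat \<Rightarrow> real) \<Rightarrow> (nat \<Rightarrow> nat \<Rightarrow> real) set" where
  "budget_set E t h p q = {c \<in> cons_set E t.
     (\<Sum>i<ncom E t. p i * (c t i - endow E h t i)) +
     (\<Sum>i<ncom E (Suc t). q i * (c (Suc t) i - endow E h (Suc t) i)) \<le> 0}"

definition demand ::
    "economy \<Rightarrow> nat \<Rightarrow> nat \<Rightarrow> (nat \<Rightarrow> real) \<Rightarrow> (nat \<Rightarrow> real) \<Rightarrow> (nat \<Rightarrow> nat \<Rightarrow> real)" where
  "demand E t h p q = arg_max_on (util E h) (budget_set E t h p q)"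

text \<open>The series over generations have at most two non-zero terms in each coordinate.\<close>

definition olg_economy :: "economy \<Rightarrow> bool" where
  "olg_economy E \<longleftrightarrow>
     (\<forall>t. 1 \<le> ncom E t) \<and>
     (\<forall>t. finite (gen E t) \<and> gen E t \<noteq> {}) \<and>
     disjoint_family (gen E) \<and> (\<Union>t. gen E t) = UNIV \<and>
     (\<forall>t. \<forall>h\<in>gen E t.
        endow E h \<in> cons_set E t \<and> endow E h \<noteq> (\<lambda>s i. 0) \<and>
        continuous_on (cons_set E t) (util E h) \<and>
        nondecreasing_on (cons_set E t) (util E h) \<and>
        no_local_max_on (cons_set E t) (util E h) \<and>
        semistrictly_quasiconcave_on (cons_set E t) (util E h)) \<and>
     (\<forall>s. \<forall>i<ncom E s. 0 < (\<Sum>t. \<Sum>h\<in>gen E t. endow E h s i)) \<and>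
     (\<forall>t. \<forall>h\<in>gen E t. \<forall>p\<in>pos_vec (ncom E t). \<forall>q\<in>pos_vec (ncom E (Suc t)).
        \<exists>!c. is_arg_max (util E h) (\<lambda>c. c \<in> budget_set E t h p q) c)"

definition excess_demand ::
    "economy \<Rightarrow> nat \<Rightarrow> (nat \<Rightarrow> real) \<Rightarrow> (nat \<Rightarrow> real) \<Rightarrow> (nat \<Rightarrow> real) \<Rightarrow> nat \<Rightarrow> real" where
  "excess_demand E t p0 p1 p2 i =
     (\<Sum>h\<in>gen E (t - 1). demand E (t - 1) h p0 p1 t i - endow E h t i) +
     (\<Sum>h\<in>gen E t. demand E t h p1 p2 t i - endow E h t i)"

definition savings :: "economy \<Rightarrow> nat \<Rightarrow> nat \<Rightarrow> (nat \<Rightarrow> real) \<Rightarrow> (nat \<Rightarrow> real) \<Rightarrow> real" where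
  "savings E t h p q =
     (\<Sum>i<ncom E t. p i / norm1 (ncom E t) p * (endow E h t i - demand E t h p q t i))"

text \<open>Aggregate endowment, in period \<open>s\<close>, of the households born in period \<open>t\<close>.\<close>

definition gen_endow :: "economy \<Rightarrow> nat \<Rightarrow> nat \<Rightarrow> real" where
  "gen_endow E t s = (\<Sum>h\<in>gen E t. norm1 (ncom E s) (endow E h s))"

text \<open>As \<open>amin > 0\<close>, the bounds force the denominator to be non-zero.\<close>

definition bounded_growth :: "economy \<Rightarrow> real \<Rightarrow> real \<Rightarrow> bool" where
  "bounded_growth E amin amax \<longleftrightarrow> 0 < amin \<and> amin < amax \<and>
     (\<forall>t. gen_endow E (Suc t) (Suc t) / gen_endow E t (Suc t) \<in> {amin<..<amax})"

definition beta :: "real \<Rightarrow> real \<Rightarrow> real" where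
  "beta amin amax = max (1 + inverse amin) (1 + amax)"

definition early_households :: "economy \<Rightarrow> nat \<Rightarrow> nat set" where
  "early_households E j = (\<Union>t\<le>j. gen E t)"

definition allocations :: "economy \<Rightarrow> nat \<Rightarrow> (nat \<Rightarrow> nat \<Rightarrow> nat \<Rightarrow> real) set" where
  "allocations E j = {c. \<forall>t\<le>j. \<forall>h\<in>gen E t. c h \<in> cons_set E t}"

definition resource_related :: "economy \<Rightarrow> nat \<Rightarrow> nat \<Rightarrow> nat \<Rightarrow> bool" where
  "resource_related E j h' h'' \<longleftrightarrow>
     h' \<in> early_households E j \<and> h'' \<in> early_households E j \<and>
     (\<forall>c\<in>allocations E j.
        (\<forall>s i. (\<Sum>t\<le>j. \<Sum>h\<in>gen E t. c h s i) \<le> (\<Sum>t\<le>j. \<Sum>h\<in>gen E t. endow E h s i)) \<longrightarrow>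
        (\<exists>c'\<in>allocations E j. \<exists>y :: nat \<Rightarrow> nat \<Rightarrow> real.
           (\<forall>s i. 0 \<le> y s i) \<and>
           (\<forall>s i. \<not> (s \<le> Suc j \<and> i < ncom E s) \<longrightarrow> y s i = 0) \<and>
           (\<forall>s i. (\<Sum>t\<le>j. \<Sum>h\<in>gen E t. c' h s i)
                    \<le> (\<Sum>t\<le>j. \<Sum>h\<in>gen E t. endow E h s i) + y s i) \<and>
           (\<forall>h\<in>early_households E j. util E h (c h) \<le> util E h (c' h)) \<and>
           util E h'' (c h'') < util E h'' (c' h'') \<and>
           (\<forall>s i. 0 < y s i \<longrightarrow> 0 < endow E h' s i)))"

definition indirectly_resource_related :: "economy \<Rightarrow> nat \<Rightarrow> nat \<Rightarrow> nat \<Rightarrow> bool" where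
  "indirectly_resource_related E j = (resource_related E j)\<^sup>+\<^sup>+"

definition price_box ::
    "economy \<Rightarrow> nat \<Rightarrow> real \<Rightarrow> ((nat \<Rightarrow> real) \<times> (nat \<Rightarrow> real)) set" where
  "price_box E t s = {(p, q).
     p \<in> pos_vec (ncom E t) \<and> q \<in> pos_vec (ncom E (Suc t)) \<and>
     (\<forall>i<ncom E t. s \<le> p i \<and> p i \<le> inverse s) \<and>
     (\<forall>i<ncom E (Suc t). s \<le> q i \<and> q i \<le> inverse s)}"

definition unbounded_border_demand :: "economy \<Rightarrow> real \<Rightarrow> (nat \<Rightarrow> real) \<Rightarrow> bool" where
  "unbounded_border_demand E b \<sigma> \<longleftrightarrow>
     (\<forall>t. 0 < \<sigma> t \<and> \<sigma> t < 1 \<and>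
       (\<forall>p\<in>pos_vec (ncom E t). \<forall>q\<in>pos_vec (ncom E (Suc t)).
          (\<lambda>i. p i / p 0, \<lambda>i. q i / p 0) \<notin> price_box E t (\<sigma> t) \<longrightarrow>
          b * (\<Sum>h\<in>gen E t. bundle_norm E t (endow E h))
            < (\<Sum>h\<in>gen E t. bundle_norm E t (demand E t h p q))))"

definition equilibria :: "economy \<Rightarrow> (nat \<Rightarrow> real) \<Rightarrow> (nat \<Rightarrow> nat \<Rightarrow> real) set" where
  "equilibria E \<sigma> = {p. (\<forall>t. p t \<in> pos_vec (ncom E t)) \<and> p 0 0 = 1 \<and>
     (p 0, p 1) \<in> price_box E 0 (\<sigma> 0) \<and>
     (\<forall>t\<ge>1. \<forall>i<ncom E t. excess_demand E t (p (t - 1)) (p t) (p (Suc t)) i = 0)}"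

definition pareto_improvement ::
    "economy \<Rightarrow> (nat \<Rightarrow> nat \<Rightarrow> real) \<Rightarrow> (nat \<Rightarrow> nat \<Rightarrow> nat \<Rightarrow> real) \<Rightarrow> bool" where
  "pareto_improvement E p y \<longleftrightarrow>
     (\<forall>t. \<forall>h\<in>gen E t. y h \<in> cons_set E t) \<and>
     (\<forall>s i. (\<Sum>t. \<Sum>h\<in>gen E t. y h s i - demand E t h (p t) (p (Suc t)) s i) = 0) \<and>
     (\<forall>t. \<forall>h\<in>gen E t. util E h (demand E t h (p t) (p (Suc t))) \<le> util E h (y h)) \<and>
     (\<exists>t. \<exists>h\<in>gen E t. util E h (demand E t h (p t) (p (Suc t))) < util E h (y h))"

definition PO_equilibria :: "economy \<Rightarrow> (nat \<Rightarrow> real) \<Rightarrow> (nat \<Rightarrow> nat \<Rightarrow> real) set" where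
  "PO_equilibria E \<sigma> = {p \<in> equilibria E \<sigma>. \<not> (\<exists>y. pareto_improvement E p y)}"

definition generalized_Cass :: "economy \<Rightarrow> (nat \<Rightarrow> real) \<Rightarrow> bool" where
  "generalized_Cass E \<sigma> \<longleftrightarrow> (\<forall>p\<in>equilibria E \<sigma>.
     p \<in> PO_equilibria E \<sigma> \<longleftrightarrow>
     filterlim (\<lambda>n. \<Sum>t\<le>n. 1 / (norm1 (ncom E t) (p t) * gen_endow E t t)) at_top sequentially)"

definition prone_to_savings :: "economy \<Rightarrow> (nat \<Rightarrow> real) \<Rightarrow> real \<Rightarrow> real \<Rightarrow> bool" where
  "prone_to_savings E \<sigma> \<epsilon> \<delta> \<longleftrightarrow>
     (\<forall>t. \<forall>p\<in>pos_vec (ncom E t). \<forall>q\<in>pos_vec (ncom E (Suc t)).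
        (\<lambda>i. p i / p 0, \<lambda>i. q i / p 0) \<in> price_box E t (\<sigma> t) \<longrightarrow>
        (\<Sum>h\<in>gen E t. savings E t h p q) / gen_endow E t t \<le> \<delta> \<longrightarrow>
        norm1 (ncom E t) p / norm1 (ncom E (Suc t)) q
          \<le> 1 / (1 + \<epsilon>) * (gen_endow E (Suc t) (Suc t) / gen_endow E t t))"

end

theory Submission
  imports Defs
begin

text \<open>
  Nominal savings \<open>S\<close> of the young are constant along an equilibrium.  Writing
  \<open>w\<^sub>t = \<parallel>p\<^sub>t\<parallel> \<Sum>\<parallel>e\<^sub>t\<parallel>\<close>, with the sum over generation \<open>t\<close>, proneness to savings says that
  \<open>S \<le> \<delta> w\<^sub>t\<close> forces \<open>w\<close> to grow by the factor \<open>1 + \<epsilon>\<close>, and hence geometrically from then on.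
  By the Cass criterion an equilibrium is therefore Pareto optimal iff \<open>\<delta> w\<^sub>t \<le> S\<close> for all \<open>t\<close>; this
  is a closed condition in a compact set of prices.  For existence, truncate the economy at \<open>T\<close> and
  hand the period \<open>T + 1\<close> endowments of generation \<open>T + 1\<close> to a household consuming in period
  \<open>0\<close>.  In the truncated equilibrium \<open>S\<close> is at least a fixed fraction of \<open>w\<^bsub>T+1\<^esub>\<close>, because relative
  prices and the numbers of commodities are uniformly bounded; so \<open>\<delta> w\<^sub>t \<le> S\<close> for all \<open>t\<close> up to \<open>T\<close>
  minus a constant, and one lets \<open>T\<close> tend to infinity.
\<close>

subsection \<open>Complementarity on cubes\<close>

lemma tendsto_fun_iff:
  fixes f :: "'a \<Rightarrow> 'i \<Rightarrow> 'b::topological_space"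
  shows "(f \<longlongrightarrow> l) F \<longleftrightarrow> (\<forall>i. ((\<lambda>x. f x i) \<longlongrightarrow> l i) F)"
proof -
  have "(f \<longlongrightarrow> l) F \<longleftrightarrow> limitin (product_topology (\<lambda>i. euclidean) UNIV) f l F"
    by (simp only: limitin_canonical_iff[symmetric] euclidean_product_topology[symmetric])
  then show ?thesis
    by (simp add: limitin_componentwise limitin_canonical_iff)
qed

lemma compact_fun_box:
  fixes C :: "'i \<Rightarrow> 'b::topological_space set"
  assumes "\<And>i. compact (C i)"
  shows "compact {x. \<forall>i. x i \<in> C i}"
proof -
  have "{x. \<forall>i. x i \<in> C i} = PiE UNIV C" by (auto simp: PiE_def)
  moreover have "compactin (product_topology (\<lambda>i. euclidean) UNIV) (PiE UNIV C)"
    using assms by (simp add: compactin_PiE)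
  ultimately show ?thesis
    by (simp only: euclidean_product_topology compactin_euclidean_iff)
qed

lemma compact_box2:
  fixes lo hi :: "nat \<Rightarrow> nat \<Rightarrow> real"
  shows "compact {x. \<forall>s i. lo s i \<le> x s i \<and> x s i \<le> hi s i}"
proof -
  have "compact {x. \<forall>s. x s \<in> {y. \<forall>i. y i \<in> {lo s i..hi s i}}}"
    by (intro compact_fun_box) simp
  then show ?thesis by simp
qed

lemma continuous_on_eval2 [continuous_intros]:
  fixes S :: "(nat \<Rightarrow> nat \<Rightarrow> real) set"
  shows "continuous_on S (\<lambda>x. x s i)"
  by (intro continuous_on_product_then_coordinatewise[where f = "\<lambda>x. x s"]
      continuous_on_subset[OF continuous_on_product_coordinates]) auto

text \<open>Otherwise infinitely many terms stay at some distance from \<open>l\<close>, and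
  compactness extracts from them a convergent subsequence with another limit. Continuity of demand
  thereby reduces to identifying limits of convergent subsequences.\<close>

lemma tendsto_via_subseq_limits:
  fixes y :: "nat \<Rightarrow> 'a::metric_space"
  assumes C: "compact C" "\<And>n. y n \<in> C"
    and *: "\<And>r l'. strict_mono (r::nat\<Rightarrow>nat) \<Longrightarrow> (\<lambda>n. y (r n)) \<longlonglongrightarrow> l' \<Longrightarrow> l' = l"
  shows "y \<longlonglongrightarrow> l"
proof (rule ccontr)
  assume "\<not> ?thesis"
  then obtain e where e: "e > 0" and "\<forall>N. \<exists>n\<ge>N. e \<le> dist (y n) l"
    unfolding lim_sequentially by (meson not_less)
  then have "infinite {n. e \<le> dist (y n) l}"
    by (auto simp: infinite_nat_iff_unbounded_le)
  then obtain r :: "nat \<Rightarrow> nat" where r: "strict_mono r" "\<And>n. e \<le> dist (y (r n)) l"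
    using infinite_enumerate by blast
  obtain l' r' where r': "strict_mono (r' :: nat \<Rightarrow> nat)" "((\<lambda>n. y (r n)) \<circ> r') \<longlonglongrightarrow> l'"
    using C compact_imp_seq_compact seq_compactE by metis
  have "(\<lambda>n. y ((r \<circ> r') n)) \<longlonglongrightarrow> l'" "strict_mono (r \<circ> r')"
    using r r' by (auto simp: o_def strict_mono_def)
  then have "(\<lambda>n. y (r (r' n))) \<longlonglongrightarrow> l"
    using * by fastforce
  then have "\<exists>n. dist (y (r (r' n))) l < e"
    using e(1) unfolding lim_sequentially by blast
  then show False using r(2) by (meson not_less)
qed

text \<open>Kuhn's combinatorial lemma, applied to ever finer grids of the box, gives cells that
  carry both labels in every coordinate; a limit of such cells is the required point. With
  \<open>F\<close> read as excess demand this is the fixed point argument for existence of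
  equilibrium: excess demand only at a price ceiling, excess supply only at a price floor.\<close>

lemma box_complementarity_nat:
  fixes F :: "(nat \<Rightarrow> real) \<Rightarrow> nat \<Rightarrow> real" and n :: nat
  assumes le: "\<And>i. lo i \<le> hi i"
    and cont: "\<And>i. i < n \<Longrightarrow> continuous_on {x. \<forall>i. lo i \<le> x i \<and> x i \<le> hi i} (\<lambda>x. F x i)"
  obtains x where "\<And>i. lo i \<le> x i \<and> x i \<le> hi i"
    "\<And>i. i < n \<Longrightarrow> 0 < F x i \<Longrightarrow> x i = hi i" "\<And>i. i < n \<Longrightarrow> F x i < 0 \<Longrightarrow> x i = lo i"
proof -
  define B where "B = {x. \<forall>i. lo i \<le> x i \<and> x i \<le> hi i}"
  \<comment> \<open>The grid with \<open>Suc k\<close> steps per side; coordinates from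
    \<open>n\<close> on are frozen at their lower bound.\<close>
  define pt where "pt k q = (\<lambda>i. if i < n then lo i + real (q i) / real (Suc k) * (hi i - lo i) else lo i)"
    for k :: nat and q :: "nat \<Rightarrow> nat"
  \<comment> \<open>Kuhn's lemma prescribes the labels on the faces. A vertex labelled 1 at which
    \<open>F\<close> is positive must lie on the upper face, a vertex labelled 0 at which
    \<open>F\<close> is negative on the lower face.\<close>
  define lab where "lab k q i = (if q i = 0 then 0 else if q i = Suc k then 1
      else if 0 < F (pt k q) i then 0 else (1::nat))" for k q i
  have ptB: "pt k q \<in> B" if "\<And>i. i < n \<Longrightarrow> q i \<le> Suc k" for k q
  proof -
    have "lo i \<le> pt k q i \<and> pt k q i \<le> hi i" for i
    proof (cases "i < n")
      case True
      then have "0 \<le> real (q i) / real (Suc k)" "real (q i) / real (Suc k) \<le> 1"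
        using that[OF True] by (auto simp: divide_le_eq_1 simp del: of_nat_Suc)
      moreover have "0 \<le> hi i - lo i" using le by simp
      ultimately have "0 \<le> real (q i) / real (Suc k) * (hi i - lo i)"
        "real (q i) / real (Suc k) * (hi i - lo i) \<le> hi i - lo i"
        by (blast intro: mult_nonneg_nonneg mult_left_le_one_le)+
      then show ?thesis using True by (simp add: pt_def del: of_nat_Suc)
    qed (use le in \<open>simp add: pt_def\<close>)
    then show ?thesis by (simp add: B_def)
  qed
  define near where "near q u \<longleftrightarrow> (\<forall>j<n. q j \<le> u j \<and> u j \<le> q j + 1)" for q u :: "nat \<Rightarrow> nat"
  have "\<exists>q r s. (\<forall>i<n. q i < Suc k) \<and>
      (\<forall>i<n. near q (r i) \<and> near q (s i) \<and> lab k (r i) i = 0 \<and> lab k (s i) i = 1)" for k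
  proof -
    have l: "\<forall>x. (\<forall>i<n. x i \<le> Suc k) \<longrightarrow> (\<forall>i<n. lab k x i = 0 \<or> lab k x i = 1)"
      "\<forall>x. (\<forall>i<n. x i \<le> Suc k) \<longrightarrow> (\<forall>i<n. x i = 0 \<longrightarrow> lab k x i = 0)"
      "\<forall>x. (\<forall>i<n. x i \<le> Suc k) \<longrightarrow> (\<forall>i<n. x i = Suc k \<longrightarrow> lab k x i = 1)"
      by (simp_all add: lab_def)
    obtain q where q: "\<forall>i<n. q i < Suc k"
      "\<forall>i<n. \<exists>r s. (\<forall>j<n. q j \<le> r j \<and> r j \<le> q j + 1) \<and> (\<forall>j<n. q j \<le> s j \<and> s j \<le> q j + 1) \<and>
        lab k r i \<noteq> lab k s i"
      by (rule kuhn_lemma[OF zero_less_Suc l])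
    have lab01: "lab k u i = 0 \<or> lab k u i = 1" for u i
      by (simp add: lab_def)
    have "\<exists>r s. near q r \<and> near q s \<and> lab k r i = 0 \<and> lab k s i = 1" if "i < n" for i
      using q(2)[folded near_def] that lab01 by metis
    then have "\<exists>r s. \<forall>i<n. near q (r i) \<and> near q (s i) \<and> lab k (r i) i = 0 \<and> lab k (s i) i = 1"
      by metis
    then show ?thesis using q(1) by blast
  qed
  then obtain q r s where q: "\<And>k i. i < n \<Longrightarrow> q k i < Suc k"
    and nr: "\<And>k i. i < n \<Longrightarrow> near (q k) (r k i)" and ns: "\<And>k i. i < n \<Longrightarrow> near (q k) (s k i)"
    and lab: "\<And>k i. i < n \<Longrightarrow> lab k (r k i) i = 0" "\<And>k i. i < n \<Longrightarrow> lab k (s k i) i = 1"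
    by metis
  have r: "q k j \<le> r k i j \<and> r k i j \<le> q k j + 1 \<and> r k i j \<le> Suc k"
    and s: "q k j \<le> s k i j \<and> s k i j \<le> q k j + 1 \<and> s k i j \<le> Suc k" if "i < n" "j < n" for k i j
    using nr[OF that(1), of k] ns[OF that(1), of k] q[OF that(2), of k] that(2) by (auto simp: near_def)
  have "compact B" unfolding B_def using compact_fun_box[of "\<lambda>i. {lo i..hi i}"] by simp
  moreover have "\<forall>k. pt k (q k) \<in> B" using ptB q less_imp_le by blast
  ultimately obtain x g where x: "x \<in> B" and g: "strict_mono (g :: nat \<Rightarrow> nat)"
    and lim: "((\<lambda>k. pt k (q k)) \<circ> g) \<longlonglongrightarrow> x"
    using compact_imp_seq_compact seq_compactE by metis
  \<comment> \<open>The sides of the cells shrink to 0, so every choice of vertices of the selected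
    cells has the same limit \<open>x\<close>.\<close>
  have lim': "(\<lambda>k. pt (g k) (u (g k))) \<longlonglongrightarrow> x"
    if u: "\<And>k j. j < n \<Longrightarrow> q k j \<le> u k j \<and> u k j \<le> q k j + 1" for u
    unfolding tendsto_fun_iff
  proof
    fix j
    have limj: "(\<lambda>k. pt (g k) (q (g k)) j) \<longlonglongrightarrow> x j"
      using lim by (simp add: tendsto_fun_iff o_def)
    show "(\<lambda>k. pt (g k) (u (g k)) j) \<longlonglongrightarrow> x j"
    proof (cases "j < n")
      case True
      have "(\<lambda>k. pt (g k) (u (g k)) j - pt (g k) (q (g k)) j) \<longlonglongrightarrow> 0"
      proof (rule tendsto_sandwich[of "\<lambda>_. 0" _ _ "\<lambda>k. inverse (real (Suc (g k))) * (hi j - lo j)"])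
        have eq: "pt k (u k) j - pt k (q k) j = (real (u k j) - real (q k j)) / real (Suc k) * (hi j - lo j)" for k
          using True by (simp add: pt_def field_simps del: of_nat_Suc)
        have b: "0 \<le> real (u k j) - real (q k j)" "real (u k j) - real (q k j) \<le> 1" for k
          using u[OF True, of k] by auto
        show "\<forall>\<^sub>F k in sequentially. 0 \<le> pt (g k) (u (g k)) j - pt (g k) (q (g k)) j"
          unfolding eq using b le[of j] by (intro always_eventually allI mult_nonneg_nonneg divide_nonneg_nonneg) auto
        show "\<forall>\<^sub>F k in sequentially. pt (g k) (u (g k)) j - pt (g k) (q (g k)) j
            \<le> inverse (real (Suc (g k))) * (hi j - lo j)"
          unfolding eq inverse_eq_divide using b le[of j]
          by (intro always_eventually allI mult_right_mono divide_right_mono) auto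
        have "(\<lambda>k. inverse (real (Suc (g k)))) \<longlonglongrightarrow> 0"
          using LIMSEQ_subseq_LIMSEQ[OF LIMSEQ_inverse_real_of_nat g] by (simp add: o_def)
        then show "(\<lambda>k. inverse (real (Suc (g k))) * (hi j - lo j)) \<longlonglongrightarrow> 0"
          by (rule tendsto_mult_left_zero)
      qed simp
      from tendsto_add[OF this limj] show ?thesis by simp
    next
      case False
      then show ?thesis using limj by (simp add: pt_def)
    qed
  qed
  have limF: "(\<lambda>k. F (pt (g k) (u (g k))) i) \<longlonglongrightarrow> F x i" "(\<lambda>k. pt (g k) (u (g k)) i) \<longlonglongrightarrow> x i"
    if i: "i < n" and u: "\<And>k j. j < n \<Longrightarrow> q k j \<le> u k j \<and> u k j \<le> q k j + 1 \<and> u k j \<le> Suc k" for u i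
  proof -
    have l: "(\<lambda>k. pt (g k) (u (g k))) \<longlonglongrightarrow> x" using u by (intro lim') auto
    then show "(\<lambda>k. pt (g k) (u (g k)) i) \<longlonglongrightarrow> x i" by (simp add: tendsto_fun_iff)
    have "\<forall>\<^sub>F k in sequentially. pt (g k) (u (g k)) \<in> B"
      using u by (intro always_eventually allI ptB) auto
    then show "(\<lambda>k. F (pt (g k) (u (g k))) i) \<longlonglongrightarrow> F x i"
      using continuous_on_tendsto_compose[OF cont[OF i] l] x by (simp add: B_def)
  qed
  show ?thesis
  proof
    show "lo i \<le> x i \<and> x i \<le> hi i" for i using x by (simp add: B_def)
    \<comment> \<open>By continuity \<open>F\<close> is eventually positive at the vertices labelled
      1, which puts them on the upper face; the face is closed. The next case uses the vertices
      labelled 0 in the same way.\<close>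
    show "x i = hi i" if i: "i < n" and F: "0 < F x i" for i
    proof -
      note l = limF[OF i s[OF i]]
      have "\<forall>\<^sub>F k in sequentially. 0 < F (pt (g k) (s (g k) i)) i"
        using order_tendstoD(1)[OF l(1) F] .
      then have "\<forall>\<^sub>F k in sequentially. pt (g k) (s (g k) i) i = hi i"
      proof (rule eventually_mono)
        fix k assume "0 < F (pt (g k) (s (g k) i)) i"
        then have "s (g k) i i = Suc (g k)" using lab(2)[OF i, of "g k"] unfolding lab_def
          by (auto split: if_splits)
        then show "pt (g k) (s (g k) i) i = hi i" using i by (simp add: pt_def del: of_nat_Suc)
      qed
      then have "(\<lambda>k. pt (g k) (s (g k) i) i) \<longlonglongrightarrow> hi i" by (rule tendsto_eventually)
      then show ?thesis using l(2) LIMSEQ_unique by blast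
    qed
    show "x i = lo i" if i: "i < n" and F: "F x i < 0" for i
    proof -
      note l = limF[OF i r[OF i]]
      have "\<forall>\<^sub>F k in sequentially. F (pt (g k) (r (g k) i)) i < 0"
        using order_tendstoD(2)[OF l(1) F] .
      then have "\<forall>\<^sub>F k in sequentially. pt (g k) (r (g k) i) i = lo i"
      proof (rule eventually_mono)
        fix k assume "F (pt (g k) (r (g k) i)) i < 0"
        then have "r (g k) i i = 0" using lab(1)[OF i, of "g k"] unfolding lab_def
          by (auto split: if_splits)
        then show "pt (g k) (r (g k) i) i = lo i" using i by (simp add: pt_def del: of_nat_Suc)
      qed
      then have "(\<lambda>k. pt (g k) (r (g k) i) i) \<longlonglongrightarrow> lo i" by (rule tendsto_eventually)
      then show ?thesis using l(2) LIMSEQ_unique by blast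
    qed
  qed
qed

text \<open>Coding pairs as numbers reduces this to the case of one index; the codes of the finite
  set \<open>I\<close> lie below some \<open>n\<close>.\<close>

lemma box_complementarity:
  fixes F :: "(nat \<Rightarrow> nat \<Rightarrow> real) \<Rightarrow> nat \<Rightarrow> nat \<Rightarrow> real" and I :: "(nat \<times> nat) set"
  assumes "finite I" and le: "\<And>s i. lo s i \<le> hi s i"
    and cont: "\<And>s i. (s, i) \<in> I \<Longrightarrow>
      continuous_on {x. \<forall>s i. lo s i \<le> x s i \<and> x s i \<le> hi s i} (\<lambda>x. F x s i)"
  obtains x where "\<And>s i. lo s i \<le> x s i \<and> x s i \<le> hi s i"
    "\<And>s i. (s, i) \<in> I \<Longrightarrow> 0 < F x s i \<Longrightarrow> x s i = hi s i"
    "\<And>s i. (s, i) \<in> I \<Longrightarrow> F x s i < 0 \<Longrightarrow> x s i = lo s i"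
proof -
  define cu where "cu y = (\<lambda>s i. y (prod_encode (s, i)))" for y :: "nat \<Rightarrow> real"
  define lo' where "lo' k = case_prod lo (prod_decode k)" for k
  define hi' where "hi' k = case_prod hi (prod_decode k)" for k
  \<comment> \<open>Codes below \<open>n\<close> that do not come from \<open>I\<close> get the
    value 0, for which continuity is trivial and both complementarity conditions are
    vacuous.\<close>
  define F' where "F' y k = (if prod_decode k \<in> I then case_prod (F (cu y)) (prod_decode k) else 0)" for y k
  obtain n where n: "\<And>z. z \<in> I \<Longrightarrow> prod_encode z < n"
    using finite_nat_bounded[OF finite_imageI[OF \<open>finite I\<close>, of prod_encode]]
    by (metis image_eqI lessThan_iff subsetD)
  have c: "continuous_on {y. \<forall>k. lo' k \<le> y k \<and> y k \<le> hi' k} (\<lambda>y. F' y k)" for k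
  proof (cases "prod_decode k \<in> I")
    case True
    obtain s i where k: "prod_decode k = (s, i)" by fastforce
    have "continuous_on UNIV cu"
      unfolding cu_def by (intro continuous_on_coordinatewise_then_product continuous_intros) simp
    moreover have "cu y \<in> {x. \<forall>s i. lo s i \<le> x s i \<and> x s i \<le> hi s i}"
      if "y \<in> {y. \<forall>k. lo' k \<le> y k \<and> y k \<le> hi' k}" for y
    proof -
      have "lo s i \<le> cu y s i \<and> cu y s i \<le> hi s i" for s i
        using that by (auto simp: lo'_def hi'_def cu_def dest: spec[of _ "prod_encode (s, i)"])
      then show ?thesis by simp
    qed
    ultimately have "continuous_on {y. \<forall>k. lo' k \<le> y k \<and> y k \<le> hi' k} (\<lambda>y. F (cu y) s i)"
      using True k by (intro continuous_on_compose2[OF cont[of s i]])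
        (auto intro: continuous_on_subset)
    then show ?thesis using True k by (simp add: F'_def)
  qed (simp add: F'_def)
  have "lo' k \<le> hi' k" for k using le by (simp add: lo'_def hi'_def split: prod.split)
  then obtain y where y: "\<And>k. lo' k \<le> y k \<and> y k \<le> hi' k"
    "\<And>k. k < n \<Longrightarrow> 0 < F' y k \<Longrightarrow> y k = hi' k" "\<And>k. k < n \<Longrightarrow> F' y k < 0 \<Longrightarrow> y k = lo' k"
    using box_complementarity_nat[of lo' hi' n F'] c by blast
  show ?thesis
  proof
    show "lo s i \<le> cu y s i \<and> cu y s i \<le> hi s i" for s i
      using y(1)[of "prod_encode (s, i)"] by (simp add: lo'_def hi'_def cu_def)
    show "cu y s i = hi s i" if "(s, i) \<in> I" "0 < F (cu y) s i" for s i
      using y(2)[of "prod_encode (s, i)"] that n by (simp add: F'_def hi'_def cu_def)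
    show "cu y s i = lo s i" if "(s, i) \<in> I" "F (cu y) s i < 0" for s i
      using y(3)[of "prod_encode (s, i)"] that n by (simp add: F'_def lo'_def cu_def)
  qed
qed

subsection \<open>Demand\<close>

definition cost :: "economy \<Rightarrow> nat \<Rightarrow> (nat \<Rightarrow> real) \<Rightarrow> (nat \<Rightarrow> real) \<Rightarrow> (nat \<Rightarrow> nat \<Rightarrow> real) \<Rightarrow> real" where
  "cost E t p q c = (\<Sum>i<ncom E t. p i * c t i) + (\<Sum>i<ncom E (Suc t). q i * c (Suc t) i)"

text \<open>Positivity alone, without normalization or market clearing: the domain on which all
  demands are continuous functions of the whole price sequence.\<close>

definition price_systems :: "economy \<Rightarrow> (nat \<Rightarrow> nat \<Rightarrow> real) set" where
  "price_systems E = {p. \<forall>t. p t \<in> pos_vec (ncom E t)}"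

lemma price_systemsD:
  assumes "p \<in> price_systems E"
  shows "p t \<in> pos_vec (ncom E t)" "i < ncom E t \<Longrightarrow> 0 < p t i"
  using assms by (auto simp: price_systems_def pos_vec_def)

lemma cons_setD:
  assumes "c \<in> cons_set E t"
  shows "0 \<le> c s i" "s \<noteq> t \<Longrightarrow> s \<noteq> Suc t \<Longrightarrow> c s i = 0" "ncom E s \<le> i \<Longrightarrow> c s i = 0"
  using assms by (auto simp: cons_set_def)

lemma mem_budget_set_iff:
  "c \<in> budget_set E t h p q \<longleftrightarrow> c \<in> cons_set E t \<and> cost E t p q c \<le> cost E t p q (endow E h)"
  by (simp add: budget_set_def cost_def right_diff_distrib sum_subtractf) argo

lemma cost_scale: "cost E t p q (\<lambda>s i. a * c s i) = a * cost E t p q c"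
  by (simp add: cost_def sum_distrib_left distrib_left mult.left_commute)

lemma cost_nonneg:
  assumes "p \<in> pos_vec (ncom E t)" "q \<in> pos_vec (ncom E (Suc t))" "c \<in> cons_set E t"
  shows "0 \<le> cost E t p q c"
  using assms unfolding cost_def
  by (intro add_nonneg_nonneg sum_nonneg mult_nonneg_nonneg) (auto simp: pos_vec_def cons_set_def less_imp_le)

lemma cost_ge_term:
  assumes "p \<in> price_systems E" "c \<in> cons_set E t" "s = t \<or> s = Suc t" "i < ncom E s"
  shows "p s i * c s i \<le> cost E t (p t) (p (Suc t)) c"
proof -
  have nn: "0 \<le> p s i * c s i" if "i < ncom E s" for s i
    using price_systemsD(2)[OF assms(1) that] cons_setD(1)[OF assms(2)] by (simp add: less_imp_le)
  have le: "p s i * c s i \<le> (\<Sum>i<ncom E s. p s i * c s i)"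
    using assms(4) nn by (intro member_le_sum) auto
  have nonneg: "0 \<le> (\<Sum>i<ncom E s. p s i * c s i)" for s
    by (intro sum_nonneg nn) simp
  show ?thesis
    using assms(3)
  proof
    assume "s = t"
    then show ?thesis using le nonneg[of "Suc t"] unfolding \<open>s = t\<close> cost_def by linarith
  next
    assume "s = Suc t"
    then show ?thesis using le nonneg[of t] unfolding \<open>s = Suc t\<close> cost_def by linarith
  qed
qed

lemma tendsto_cost:
  assumes "P \<longlonglongrightarrow> p" "C \<longlonglongrightarrow> c"
  shows "(\<lambda>k. cost E t (P k t) (P k (Suc t)) (C k)) \<longlonglongrightarrow> cost E t (p t) (p (Suc t)) c"
  unfolding cost_def using assms
  by (intro tendsto_intros) (simp_all add: tendsto_fun_iff)

section \<open>Household demand: optimality, exhaustion of the budget, continuity\<close>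

locale olg =
  fixes E :: economy
  assumes olg: "olg_economy E"
begin

lemma ncom_pos: "0 < ncom E t"
  using olg unfolding olg_economy_def by (metis Suc_le_eq One_nat_def)

lemma endow_mem: "h \<in> gen E t \<Longrightarrow> endow E h \<in> cons_set E t"
  using olg unfolding olg_economy_def by blast

lemma endow_cost_pos:
  assumes h: "h \<in> gen E t" and p: "p \<in> price_systems E"
  shows "0 < cost E t (p t) (p (Suc t)) (endow E h)"
proof -
  have "endow E h \<noteq> (\<lambda>s i. 0)" using olg h unfolding olg_economy_def by blast
  then obtain s i where si: "endow E h s i \<noteq> 0" by (auto simp: fun_eq_iff)
  have *: "s = t \<or> s = Suc t" "i < ncom E s" "0 < endow E h s i"
    using cons_setD[OF endow_mem[OF h], of s i] si by (auto simp: not_less[symmetric])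
  then have "0 < p s i * endow E h s i" using price_systemsD(2)[OF p] by simp
  also have "\<dots> \<le> cost E t (p t) (p (Suc t)) (endow E h)"
    using cost_ge_term[OF p endow_mem[OF h]] * by blast
  finally show ?thesis .
qed

text \<open>\<open>demand\<close> is a choice among maximizers; the assumed unique existence makes
  it the actual maximizer.\<close>

lemma
  assumes h: "h \<in> gen E t" and p: "p \<in> pos_vec (ncom E t)" and q: "q \<in> pos_vec (ncom E (Suc t))"
  shows demand_in_budget_set: "demand E t h p q \<in> budget_set E t h p q"
    and demand_max: "c \<in> budget_set E t h p q \<Longrightarrow> util E h c \<le> util E h (demand E t h p q)"
    and demand_unique: "\<lbrakk>c \<in> budget_set E t h p q;
      \<And>c'. c' \<in> budget_set E t h p q \<Longrightarrow> util E h c' \<le> util E h c\<rbrakk> \<Longrightarrow> c = demand E t h p q"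
proof -
  have ex: "\<exists>!c. is_arg_max (util E h) (\<lambda>c. c \<in> budget_set E t h p q) c"
    using olg h p q unfolding olg_economy_def by blast
  then have am: "is_arg_max (util E h) (\<lambda>c. c \<in> budget_set E t h p q) (demand E t h p q)"
    unfolding demand_def arg_max_on_def arg_max_def by (rule ex1_implies_ex[THEN someI_ex])
  then show "demand E t h p q \<in> budget_set E t h p q"
    and "c \<in> budget_set E t h p q \<Longrightarrow> util E h c \<le> util E h (demand E t h p q)"
    by (auto simp: is_arg_max_linorder)
  show "c = demand E t h p q" if "c \<in> budget_set E t h p q"
      "\<And>c'. c' \<in> budget_set E t h p q \<Longrightarrow> util E h c' \<le> util E h c"
  proof -
    have "is_arg_max (util E h) (\<lambda>c. c \<in> budget_set E t h p q) c"
      using that by (auto simp: is_arg_max_linorder)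
    then show ?thesis using ex am by blast
  qed
qed

lemma demand_mem:
  "\<lbrakk>h \<in> gen E t; p \<in> price_systems E\<rbrakk> \<Longrightarrow> demand E t h (p t) (p (Suc t)) \<in> cons_set E t"
  using demand_in_budget_set price_systemsD(1) by (simp add: mem_budget_set_iff)

text \<open>If income were left over, all bundles near the demanded one would be affordable, and one
  of them is better since utility has no local maximum.\<close>

lemma cost_demand:
  assumes h: "h \<in> gen E t" and P: "p \<in> price_systems E"
  shows "cost E t (p t) (p (Suc t)) (demand E t h (p t) (p (Suc t))) =
    cost E t (p t) (p (Suc t)) (endow E h)"
proof (rule ccontr)
  let ?p = "p t" and ?q = "p (Suc t)"
  let ?x = "demand E t h ?p ?q"
  note pq = price_systemsD(1)[OF P, of t] price_systemsD(1)[OF P, of "Suc t"]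
  assume "\<not> ?thesis"
  then have lt: "cost E t ?p ?q ?x < cost E t ?p ?q (endow E h)"
    using demand_in_budget_set[OF h pq] by (simp add: mem_budget_set_iff)
  define U where "U = {c. cost E t ?p ?q c < cost E t ?p ?q (endow E h)}"
  have "open U" unfolding U_def cost_def by (intro open_Collect_less continuous_intros)
  moreover have "?x \<in> U" using lt by (simp add: U_def)
  moreover have "no_local_max_on (cons_set E t) (util E h)"
    using olg h unfolding olg_economy_def by blast
  ultimately obtain c where "c \<in> U" "c \<in> cons_set E t" "util E h ?x < util E h c"
    using demand_mem[OF h P] unfolding no_local_max_on_def by blast
  then show False
    using demand_max[OF h pq, of c] by (simp add: mem_budget_set_iff U_def)
qed

text \<open>The budget correspondence is lower hemicontinuous because every income is positive.\<close>

lemma continuous_on_demand: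
  assumes h: "h \<in> gen E t"
  shows "continuous_on (price_systems E) (\<lambda>p. demand E t h (p t) (p (Suc t)))"
  unfolding continuous_on_sequentially
proof (intro allI impI ballI, elim conjE)
  fix P p assume P: "\<forall>k. P k \<in> price_systems E" and p: "p \<in> price_systems E" and lim: "P \<longlonglongrightarrow> p"
  define x where "x k = demand E t h (P k t) (P k (Suc t))" for k :: nat
  define m where "m k = cost E t (P k t) (P k (Suc t)) (endow E h)" for k :: nat
  define m0 where "m0 = cost E t (p t) (p (Suc t)) (endow E h)"
  note Pk = P[rule_format]
  have xX: "x k \<in> cons_set E t" for k using demand_mem[OF h Pk] by (simp add: x_def)
  have costx: "cost E t (P k t) (P k (Suc t)) (x k) = m k" for k
    using cost_demand[OF h Pk] by (simp add: x_def m_def)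
  have mpos: "0 < m k" "0 < m0" for k using endow_cost_pos[OF h] Pk p by (auto simp: m_def m0_def)
  have limm: "m \<longlonglongrightarrow> m0" unfolding m_def m0_def by (intro tendsto_cost lim tendsto_const)
  \<comment> \<open>Each demanded quantity is at most income over price, a convergent and hence
    bounded sequence. So all \<open>x k\<close> lie in one compact box.\<close>
  have "\<exists>M. \<forall>k. x k s i \<le> M" for s i
  proof (cases "(s = t \<or> s = Suc t) \<and> i < ncom E s")
    case True
    then have pos: "0 < P k s i" "0 < p s i" for k
      using True price_systemsD(2)[OF Pk] price_systemsD(2)[OF p] by blast+
    have "(\<lambda>k. m k / P k s i) \<longlonglongrightarrow> m0 / p s i"
      using limm lim pos(2) by (intro tendsto_divide) (auto simp: tendsto_fun_iff)
    then have "Bseq (\<lambda>k. m k / P k s i)" by (rule convergent_imp_Bseq[OF convergentI])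
    then obtain M where M: "\<And>k. norm (m k / P k s i) \<le> M" unfolding Bseq_def by blast
    have xle: "x k s i \<le> m k / P k s i" for k
      using cost_ge_term[OF Pk xX, of s i k k] True costx[of k] pos(1)[of k] by (simp add: field_simps)
    have "x k s i \<le> M" for k
      using xle[of k] M[of k] unfolding real_norm_def by linarith
    then show ?thesis by blast
  next
    case False
    then have "x k s i \<le> 0" for k using xX[of k] by (auto simp: cons_set_def)
    then show ?thesis by blast
  qed
  then obtain M where M: "\<And>s i k. x k s i \<le> M s i" by metis
  show "((\<lambda>p. demand E t h (p t) (p (Suc t))) \<circ> P) \<longlonglongrightarrow> demand E t h (p t) (p (Suc t))"
    unfolding o_def x_def[symmetric]
  proof (rule tendsto_via_subseq_limits[OF compact_box2[of "\<lambda>s i. 0" M]])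
    show "x k \<in> {x. \<forall>s i. 0 \<le> x s i \<and> x s i \<le> M s i}" for k
      using M cons_setD(1)[OF xX] by simp
    fix r l assume r: "strict_mono (r :: nat \<Rightarrow> nat)" and xl: "(\<lambda>k. x (r k)) \<longlonglongrightarrow> l"
    have Pr: "(\<lambda>k. P (r k)) \<longlonglongrightarrow> p" using LIMSEQ_subseq_LIMSEQ[OF lim r] by (simp add: o_def)
    have mr: "(\<lambda>k. m (r k)) \<longlonglongrightarrow> m0" using LIMSEQ_subseq_LIMSEQ[OF limm r] by (simp add: o_def)
    have xli: "(\<lambda>k. x (r k) s i) \<longlonglongrightarrow> l s i" for s i using xl by (simp add: tendsto_fun_iff)
    have lX: "l \<in> cons_set E t"
    proof -
      have "0 \<le> l s i" for s i
        using cons_setD(1)[OF xX] by (intro LIMSEQ_le_const[OF xli]) auto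
      moreover have "l s i = 0" if "\<not> (s \<in> {t, Suc t} \<and> i < ncom E s)" for s i
      proof -
        have "x (r k) s i = 0" for k using xX[of "r k"] that by (auto simp: cons_set_def)
        then show ?thesis using xli[of s i] by (simp add: LIMSEQ_const_iff)
      qed
      ultimately show ?thesis by (simp add: cons_set_def)
    qed
    have uc: "continuous_on (cons_set E t) (util E h)"
      using olg h unfolding olg_economy_def by blast
    note pq = price_systemsD(1)[OF p, of t] price_systemsD(1)[OF p, of "Suc t"]
    show "l = demand E t h (p t) (p (Suc t))"
    proof (rule demand_unique[OF h pq])
      have "(\<lambda>k. m (r k)) \<longlonglongrightarrow> cost E t (p t) (p (Suc t)) l"
        using tendsto_cost[OF Pr xl, of E t] by (simp add: costx)
      then have "cost E t (p t) (p (Suc t)) l = m0" using mr LIMSEQ_unique by blast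
      then show "l \<in> budget_set E t h (p t) (p (Suc t))"
        using lX by (simp add: mem_budget_set_iff m0_def)
      fix c assume c: "c \<in> budget_set E t h (p t) (p (Suc t))"
      then have cX: "c \<in> cons_set E t" and cc: "cost E t (p t) (p (Suc t)) c \<le> m0"
        by (auto simp: mem_budget_set_iff m0_def)
      define cst where "cst k = cost E t (P (r k) t) (P (r k) (Suc t)) c" for k
      have cst0: "0 \<le> cst k" for k unfolding cst_def
        by (rule cost_nonneg[OF price_systemsD(1)[OF Pk] price_systemsD(1)[OF Pk] cX])
      \<comment> \<open>The factor by which \<open>c\<close>, affordable at the limit prices, is
        shrunk to be affordable at the prices \<open>P (r k)\<close>. It tends to 1 because the
        limit cost of \<open>c\<close> is at most the positive limit income
        \<open>m0\<close>.\<close>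
      define a where "a k = m (r k) / max (cst k) (m (r k))" for k
      have a0: "0 \<le> a k" for k unfolding a_def
        using mpos cst0 by (intro divide_nonneg_nonneg) (auto simp: max_def less_imp_le)
      define y where "y k = (\<lambda>s i. a k * c s i)" for k
      have yX: "y k \<in> cons_set E t" for k
        using cX a0 by (auto simp: cons_set_def y_def)
      have "a k * cst k \<le> m (r k)" for k
      proof -
        have "cst k / max (cst k) (m (r k)) \<le> 1" using mpos(1)[of "r k"] by (auto simp: divide_le_eq_1 max_def)
        then have "m (r k) * (cst k / max (cst k) (m (r k))) \<le> m (r k)"
          by (intro mult_left_le less_imp_le[OF mpos(1)])
        then show ?thesis by (simp add: a_def)
      qed
      then have "y k \<in> budget_set E t h (P (r k) t) (P (r k) (Suc t))" for k
        using yX by (simp add: mem_budget_set_iff y_def cost_scale cst_def m_def)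
      then have le: "util E h (y k) \<le> util E h (x (r k))" for k
        unfolding x_def using demand_max[OF h price_systemsD(1)[OF Pk] price_systemsD(1)[OF Pk]] by blast
      have "cst \<longlonglongrightarrow> cost E t (p t) (p (Suc t)) c"
        unfolding cst_def by (intro tendsto_cost Pr tendsto_const)
      then have "(\<lambda>k. max (cst k) (m (r k))) \<longlonglongrightarrow> max (cost E t (p t) (p (Suc t)) c) m0"
        by (intro tendsto_max mr)
      then have "(\<lambda>k. max (cst k) (m (r k))) \<longlonglongrightarrow> m0" using cc by (simp add: max_def)
      then have "a \<longlonglongrightarrow> m0 / m0" unfolding a_def using mpos(2) by (intro tendsto_divide mr) auto
      then have "a \<longlonglongrightarrow> 1" using mpos(2) by simp
      then have "(\<lambda>k. y k s i) \<longlonglongrightarrow> c s i" for s i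
        unfolding y_def using tendsto_mult_right[of a 1 sequentially "c s i"] by simp
      then have "y \<longlonglongrightarrow> c" by (simp add: tendsto_fun_iff)
      then have "(\<lambda>k. util E h (y k)) \<longlonglongrightarrow> util E h c"
        using continuous_on_tendsto_compose[OF uc, of y c sequentially] cX yX by simp
      moreover have "(\<lambda>k. util E h (x (r k))) \<longlonglongrightarrow> util E h l"
        using continuous_on_tendsto_compose[OF uc xl lX] xX by simp
      ultimately show "util E h c \<le> util E h l" using le by (intro LIMSEQ_le) auto
    qed
  qed
qed

lemma continuous_on_demand_component:
  "h \<in> gen E t \<Longrightarrow> continuous_on (price_systems E) (\<lambda>p. demand E t h (p t) (p (Suc t)) s i)"
  by (intro continuous_on_product_then_coordinatewise[where f = "\<lambda>p. demand E t h (p t) (p (Suc t)) s"]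
      continuous_on_product_then_coordinatewise[where f = "\<lambda>p. demand E t h (p t) (p (Suc t))"]
      continuous_on_demand)

end

subsection \<open>Savings and Pareto optimality\<close>

definition gen_excess :: "economy \<Rightarrow> nat \<Rightarrow> (nat \<Rightarrow> nat \<Rightarrow> real) \<Rightarrow> nat \<Rightarrow> nat \<Rightarrow> real" where
  "gen_excess E t p s i =
     (\<Sum>h\<in>gen E t. demand E t h (p t) (p (Suc t)) s i - endow E h s i)"

text \<open>Aggregate real savings times the norm of the price vector. Without the deflation by that
  norm, savings are conserved along an equilibrium.\<close>

definition nominal_savings :: "economy \<Rightarrow> nat \<Rightarrow> (nat \<Rightarrow> nat \<Rightarrow> real) \<Rightarrow> real" where
  "nominal_savings E t p = - (\<Sum>i<ncom E t. p t i * gen_excess E t p t i)"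

text \<open>Its reciprocals are the terms of the Cass series, and the savings ratio is at most
  \<delta> exactly when nominal savings are at most \<delta> times this weight.\<close>

definition young_weight :: "economy \<Rightarrow> nat \<Rightarrow> (nat \<Rightarrow> nat \<Rightarrow> real) \<Rightarrow> real" where
  "young_weight E t p = norm1 (ncom E t) (p t) * gen_endow E t t"

definition gen_resources :: "economy \<Rightarrow> nat \<Rightarrow> nat \<Rightarrow> nat \<Rightarrow> real" where
  "gen_resources E t s i = (\<Sum>h\<in>gen E t. endow E h s i)"

text \<open>Since \<open>0 - 1 = 0\<close> on \<^typ>\<open>nat\<close>, the set \<open>{s - 1, s}\<close> consists of the generations alive in
  period \<open>s\<close> also for \<open>s = 0\<close>.\<close>

definition resources :: "economy \<Rightarrow> nat \<Rightarrow> nat \<Rightarrow> real" where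
  "resources E s i = (\<Sum>t\<in>{s - 1, s}. gen_resources E t s i)"

definition in_box :: "economy \<Rightarrow> (nat \<Rightarrow> real) \<Rightarrow> nat \<Rightarrow> (nat \<Rightarrow> nat \<Rightarrow> real) \<Rightarrow> bool" where
  "in_box E \<sigma> t p \<longleftrightarrow> (\<lambda>i. p t i / p t 0, \<lambda>i. p (Suc t) i / p t 0) \<in> price_box E t (\<sigma> t)"

lemma norm1_nonneg_eq: "(\<And>i. i < n \<Longrightarrow> 0 \<le> v i) \<Longrightarrow> norm1 n v = (\<Sum>i<n. v i)"
  by (simp add: norm1_def)

lemma excess_demand_Suc:
  "excess_demand E (Suc t) (p t) (p (Suc t)) (p (Suc (Suc t))) i =
     gen_excess E t p (Suc t) i + gen_excess E (Suc t) p (Suc t) i"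
  by (simp add: excess_demand_def gen_excess_def)

text \<open>Clearing denominators leaves finitely many linear inequalities, which are closed
  conditions and can be chained from period to period.\<close>

lemma in_box_iff:
  assumes p: "p \<in> price_systems E" and n: "0 < ncom E t" and \<sigma>: "0 < \<sigma> t"
  shows "in_box E \<sigma> t p \<longleftrightarrow>
    (\<forall>s\<in>{t, Suc t}. \<forall>i<ncom E s. \<sigma> t * p t 0 \<le> p s i \<and> \<sigma> t * p s i \<le> p t 0)"
proof -
  have p0: "0 < p t 0" using price_systemsD(2)[OF p n] .
  have "(\<lambda>i. p s i / p t 0) \<in> pos_vec (ncom E s)" for s
    using price_systemsD(1)[OF p, of s] p0 by (simp add: pos_vec_def)
  moreover have "\<sigma> t \<le> p s i / p t 0 \<longleftrightarrow> \<sigma> t * p t 0 \<le> p s i"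
    "p s i / p t 0 \<le> inverse (\<sigma> t) \<longleftrightarrow> \<sigma> t * p s i \<le> p t 0" for s i
    using p0 \<sigma> by (simp_all add: field_simps)
  ultimately show ?thesis by (auto simp: in_box_def price_box_def)
qed

section \<open>Value identities for generations, and aggregate endowments\<close>

context olg begin

lemma norm1_pos:
  assumes p: "p \<in> price_systems E"
  shows "0 < norm1 (ncom E t) (p t)"
proof -
  have "0 < \<bar>p t i\<bar>" if "i < ncom E t" for i using price_systemsD(2)[OF p that] by simp
  moreover have "{..<ncom E t} \<noteq> {}" using ncom_pos[of t] by (simp add: lessThan_empty_iff)
  ultimately show ?thesis unfolding norm1_def by (intro sum_pos) auto
qed

lemma generation_budget:
  assumes p: "p \<in> price_systems E"
  shows "(\<Sum>i<ncom E t. p t i * gen_excess E t p t i) +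
    (\<Sum>i<ncom E (Suc t). p (Suc t) i * gen_excess E t p (Suc t) i) = 0"
proof -
  let ?x = "\<lambda>h. demand E t h (p t) (p (Suc t))"
  have "(\<Sum>i<ncom E s. p s i * gen_excess E t p s i) =
      (\<Sum>h\<in>gen E t. \<Sum>i<ncom E s. p s i * (?x h s i - endow E h s i))" for s
    unfolding gen_excess_def sum_distrib_left by (rule sum.swap)
  then have "(\<Sum>i<ncom E t. p t i * gen_excess E t p t i) +
      (\<Sum>i<ncom E (Suc t). p (Suc t) i * gen_excess E t p (Suc t) i) =
      (\<Sum>h\<in>gen E t. cost E t (p t) (p (Suc t)) (?x h) - cost E t (p t) (p (Suc t)) (endow E h))"
    by (simp only: cost_def right_diff_distrib sum_subtractf sum.distrib)
  also have "\<dots> = 0" using cost_demand[OF _ p] by simp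
  finally show ?thesis .
qed

lemma nominal_savings_old:
  "p \<in> price_systems E \<Longrightarrow>
    nominal_savings E t p = (\<Sum>i<ncom E (Suc t). p (Suc t) i * gen_excess E t p (Suc t) i)"
  using generation_budget[of p t] by (simp add: nominal_savings_def)

text \<open>By its budget, a generation spends its savings on its excess demand when old; market
  clearing makes this the value of the excess supply of the next young.\<close>

lemma nominal_savings_Suc:
  assumes p: "p \<in> price_systems E"
    and clear: "\<And>i. i < ncom E (Suc t) \<Longrightarrow>
      gen_excess E t p (Suc t) i + gen_excess E (Suc t) p (Suc t) i = 0"
  shows "nominal_savings E (Suc t) p = nominal_savings E t p"
proof -
  have "(\<Sum>i<ncom E (Suc t). p (Suc t) i * gen_excess E t p (Suc t) i) +
      (\<Sum>i<ncom E (Suc t). p (Suc t) i * gen_excess E (Suc t) p (Suc t) i) = 0"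
    using clear by (simp add: sum.distrib[symmetric] distrib_left[symmetric])
  then show ?thesis
    by (simp add: nominal_savings_old[OF p, of t] nominal_savings_def[of E "Suc t"])
qed

lemma sum_savings:
  "(\<Sum>h\<in>gen E t. savings E t h (p t) (p (Suc t))) =
    nominal_savings E t p / norm1 (ncom E t) (p t)"
proof -
  have "(\<Sum>h\<in>gen E t. savings E t h (p t) (p (Suc t))) =
      (\<Sum>i<ncom E t. \<Sum>h\<in>gen E t. p t i / norm1 (ncom E t) (p t) *
        (endow E h t i - demand E t h (p t) (p (Suc t)) t i))"
    unfolding savings_def by (rule sum.swap)
  also have "\<dots> = (\<Sum>i<ncom E t. - (p t i * gen_excess E t p t i) / norm1 (ncom E t) (p t))"
    unfolding gen_excess_def sum_distrib_left[symmetric] sum_subtractf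
    by (intro sum.cong refl) (simp add: algebra_simps diff_divide_distrib)
  finally show ?thesis
    by (simp add: nominal_savings_def sum_negf sum_divide_distrib)
qed

lemma continuous_on_gen_excess: "continuous_on (price_systems E) (\<lambda>p. gen_excess E t p s i)"
  unfolding gen_excess_def
  by (intro continuous_intros continuous_on_demand_component)

lemma continuous_on_nominal_savings: "continuous_on (price_systems E) (nominal_savings E t)"
  unfolding nominal_savings_def
  by (intro continuous_intros continuous_on_gen_excess)

lemma continuous_on_young_weight: "continuous_on S (young_weight E t)"
  unfolding young_weight_def norm1_def by (intro continuous_intros)

lemma gen_resources_nonneg: "0 \<le> gen_resources E t s i"
  unfolding gen_resources_def
  by (intro sum_nonneg) (use endow_mem cons_setD(1) in blast)

lemma gen_resources_zero: "s \<noteq> t \<Longrightarrow> s \<noteq> Suc t \<Longrightarrow> gen_resources E t s i = 0"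
  unfolding gen_resources_def
  by (intro sum.neutral) (use endow_mem cons_setD(2) in blast)

lemma gen_endow_eq: "gen_endow E t s = (\<Sum>i<ncom E s. gen_resources E t s i)"
proof -
  have "norm1 (ncom E s) (endow E h s) = (\<Sum>i<ncom E s. endow E h s i)" if "h \<in> gen E t" for h
    using endow_mem[OF that] by (intro norm1_nonneg_eq cons_setD(1))
  then show ?thesis unfolding gen_endow_def gen_resources_def by (subst sum.swap) simp
qed

lemma sum_bundle_norm:
  assumes "\<And>h. h \<in> gen E t \<Longrightarrow> c h \<in> cons_set E t"
  shows "(\<Sum>h\<in>gen E t. bundle_norm E t (c h)) =
    (\<Sum>s\<in>{t, Suc t}. \<Sum>i<ncom E s. \<Sum>h\<in>gen E t. c h s i)"
proof -
  have "norm1 (ncom E s) (c h s) = (\<Sum>i<ncom E s. c h s i)" if "h \<in> gen E t" for h s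
    using assms[OF that] by (intro norm1_nonneg_eq cons_setD(1))
  then have "(\<Sum>h\<in>gen E t. norm1 (ncom E s) (c h s)) = (\<Sum>i<ncom E s. \<Sum>h\<in>gen E t. c h s i)" for s
    by (subst sum.swap) simp
  then show ?thesis by (simp add: bundle_norm_def sum.distrib)
qed

text \<open>Only generation 0 owns goods of period 0, so positive aggregate endowment suffices here;
  in later periods the growth bounds give positivity.\<close>

lemma gen_endow_0_pos: "0 < gen_endow E 0 0"
proof -
  have "0 < (\<Sum>t. \<Sum>h\<in>gen E t. endow E h 0 0)"
    using olg ncom_pos unfolding olg_economy_def by blast
  also have "(\<Sum>t. \<Sum>h\<in>gen E t. endow E h 0 0) = (\<Sum>t\<in>{0}. gen_resources E t 0 0)"
    unfolding gen_resources_def[symmetric] by (intro suminf_finite) (auto intro: gen_resources_zero)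
  also have "\<dots> \<le> (\<Sum>i<ncom E 0. gen_resources E 0 0 i)"
    using ncom_pos gen_resources_nonneg by (simp add: member_le_sum)
  finally show ?thesis by (simp add: gen_endow_eq)
qed

end

section \<open>Growth bounds, the border condition and growth of weights\<close>

locale prone_olg = olg +
  fixes amin amax \<epsilon> \<delta> :: real and \<sigma> :: "nat \<Rightarrow> real"
  assumes growth: "bounded_growth E amin amax"
    and border: "unbounded_border_demand E (beta amin amax) \<sigma>"
    and eps: "0 < \<epsilon>" and delta: "0 < \<delta>" and prone: "prone_to_savings E \<sigma> \<epsilon> \<delta>"
begin

lemma sigma_pos: "0 < \<sigma> t" and sigma_less: "\<sigma> t < 1"
  using border unfolding unbounded_border_demand_def by blast+

lemma gen_endow_pos: "0 < gen_endow E t t" "0 < gen_endow E t (Suc t)"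
  and growth_bounds: "amin * gen_endow E t (Suc t) < gen_endow E (Suc t) (Suc t)"
    "gen_endow E (Suc t) (Suc t) < amax * gen_endow E t (Suc t)"
proof -
  have nn: "0 \<le> gen_endow E t s" for t s
    unfolding gen_endow_eq using gen_resources_nonneg by (simp add: sum_nonneg)
  have q: "0 < amin" "amin < gen_endow E (Suc t) (Suc t) / gen_endow E t (Suc t)"
    "gen_endow E (Suc t) (Suc t) / gen_endow E t (Suc t) < amax" for t
    using growth unfolding bounded_growth_def by auto
  \<comment> \<open>The quotient exceeds \<open>amin > 0\<close>, and division by zero yields 0, so
    numerator and denominator are both non-zero.\<close>
  then have ne: "gen_endow E (Suc t) (Suc t) \<noteq> 0" "gen_endow E t (Suc t) \<noteq> 0" for t
    by (metis divide_eq_0_iff order.asym)+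
  have *: "0 < gen_endow E (Suc t) (Suc t)" "0 < gen_endow E t (Suc t)" for t
    using ne[of t] nn by (simp_all add: less_le)
  show "0 < gen_endow E t t" by (cases t) (use * gen_endow_0_pos in auto)
  show "0 < gen_endow E t (Suc t)" by (rule *)
  show "amin * gen_endow E t (Suc t) < gen_endow E (Suc t) (Suc t)"
    "gen_endow E (Suc t) (Suc t) < amax * gen_endow E t (Suc t)"
    using q(2,3)[of t] *(2)[of t] by (simp_all add: field_simps)
qed

lemma young_weight_pos: "p \<in> price_systems E \<Longrightarrow> 0 < young_weight E t p"
  unfolding young_weight_def by (intro mult_pos_pos norm1_pos gen_endow_pos)

text \<open>Proneness to savings with its denominators cleared.\<close>

lemma young_weight_growth:
  assumes p: "p \<in> price_systems E" and box: "in_box E \<sigma> t p"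
    and le: "nominal_savings E t p \<le> \<delta> * young_weight E t p"
  shows "(1 + \<epsilon>) * young_weight E t p \<le> young_weight E (Suc t) p"
proof -
  have "(\<Sum>h\<in>gen E t. savings E t h (p t) (p (Suc t))) / gen_endow E t t \<le> \<delta>"
    using le young_weight_pos[OF p, of t]
    by (simp add: sum_savings young_weight_def pos_divide_le_eq)
  then have "norm1 (ncom E t) (p t) / norm1 (ncom E (Suc t)) (p (Suc t))
      \<le> 1 / (1 + \<epsilon>) * (gen_endow E (Suc t) (Suc t) / gen_endow E t t)"
    using prone price_systemsD(1)[OF p] box unfolding prone_to_savings_def in_box_def by blast
  then have "norm1 (ncom E t) (p t) \<le> 1 / (1 + \<epsilon>) * (gen_endow E (Suc t) (Suc t) / gen_endow E t t) *
      norm1 (ncom E (Suc t)) (p (Suc t))"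
    by (simp only: pos_divide_le_eq[OF norm1_pos[OF p]])
  moreover have "e * g * (1 / e * (g' / g) * b) = g' * b" if "0 < e" "0 < g" for e g g' b :: real
    using that by simp
  ultimately show ?thesis
    using mult_left_mono[of "norm1 (ncom E t) (p t)" _ "(1 + \<epsilon>) * gen_endow E t t"]
      gen_endow_pos(1)[of t] eps
    by (fastforce simp: young_weight_def ac_simps)
qed

text \<open>The two terms of the maximum in \<open>beta\<close> serve the two periods of life:
  \<open>1 + inverse amin\<close> covers the goods of the old coexisting with generation
  \<open>t\<close>, \<open>1 + amax\<close> those of the following young. Strictness leaves room for
  approximate market clearing.\<close>

lemma supply_less:
  "(\<Sum>s\<in>{t, Suc t}. \<Sum>i<ncom E s. resources E s i) <
    beta amin amax * (\<Sum>h\<in>gen E t. bundle_norm E t (endow E h))"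
proof -
  have "gen_endow E t t + gen_endow E t (Suc t) = (\<Sum>h\<in>gen E t. bundle_norm E t (endow E h))"
    by (simp add: gen_endow_def bundle_norm_def sum.distrib)
  moreover have "(\<Sum>i<ncom E s. resources E s i) = (\<Sum>u\<in>{s - 1, s}. gen_endow E u s)" for s
    unfolding resources_def gen_endow_eq by (rule sum.swap)
  then have "(\<Sum>s\<in>{t, Suc t}. \<Sum>i<ncom E s. resources E s i) =
      (\<Sum>u\<in>{t - 1, t}. gen_endow E u t) + (gen_endow E t (Suc t) + gen_endow E (Suc t) (Suc t))"
    by simp
  moreover have am: "0 < amin" "0 < amax" using growth by (auto simp: bounded_growth_def)
  have beta: "1 \<le> beta amin amax" "1 + amax \<le> beta amin amax" "1 + inverse amin \<le> beta amin amax"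
    using am by (auto simp: beta_def)
  have new: "gen_endow E t (Suc t) + gen_endow E (Suc t) (Suc t) < beta amin amax * gen_endow E t (Suc t)"
  proof -
    have "gen_endow E t (Suc t) + gen_endow E (Suc t) (Suc t) < (1 + amax) * gen_endow E t (Suc t)"
      using growth_bounds(2)[of t] by (simp add: distrib_right)
    also have "\<dots> \<le> beta amin amax * gen_endow E t (Suc t)"
      using beta gen_endow_pos(2)[of t] by (simp add: mult_right_mono)
    finally show ?thesis .
  qed
  have old: "(\<Sum>u\<in>{t - 1, t}. gen_endow E u t) \<le> beta amin amax * gen_endow E t t"
  proof (cases t)
    case 0
    then show ?thesis using beta(1) gen_endow_pos(1)[of 0] by simp
  next
    case (Suc u)
    have "gen_endow E u t \<le> inverse amin * gen_endow E t t"
      using growth_bounds(1)[of u] am Suc by (simp add: field_simps)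
    then have "gen_endow E u t + gen_endow E t t \<le> (1 + inverse amin) * gen_endow E t t"
      by (simp add: distrib_right)
    also have "\<dots> \<le> beta amin amax * gen_endow E t t"
      using beta(3) gen_endow_pos(1)[of t] by (simp add: mult_right_mono)
    finally show ?thesis using Suc by simp
  qed
  moreover have "beta amin amax * (gen_endow E t t + gen_endow E t (Suc t)) =
      beta amin amax * gen_endow E t t + beta amin amax * gen_endow E t (Suc t)"
    by (rule distrib_left)
  ultimately show ?thesis using new old by simp
qed

text \<open>The slack \<open>\<kappa>\<close> is needed for the truncated economies, where markets clear only approximately
  before the border condition is known to hold.\<close>

lemma in_box_of_feasible:
  assumes p: "p \<in> price_systems E"
    and le: "\<And>s i. s \<in> {t, Suc t} \<Longrightarrow> i < ncom E s \<Longrightarrow>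
      (\<Sum>h\<in>gen E t. demand E t h (p t) (p (Suc t)) s i) \<le> resources E s i + \<kappa>"
    and slack: "(\<Sum>s\<in>{t, Suc t}. \<Sum>i<ncom E s. resources E s i + \<kappa>) \<le>
      beta amin amax * (\<Sum>h\<in>gen E t. bundle_norm E t (endow E h))"
  shows "in_box E \<sigma> t p"
proof (rule ccontr)
  assume "\<not> ?thesis"
  then have "beta amin amax * (\<Sum>h\<in>gen E t. bundle_norm E t (endow E h))
      < (\<Sum>h\<in>gen E t. bundle_norm E t (demand E t h (p t) (p (Suc t))))"
    using border price_systemsD(1)[OF p] unfolding unbounded_border_demand_def in_box_def by blast
  also have "\<dots> = (\<Sum>s\<in>{t, Suc t}. \<Sum>i<ncom E s. \<Sum>h\<in>gen E t. demand E t h (p t) (p (Suc t)) s i)"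
    by (intro sum_bundle_norm demand_mem p)
  also have "\<dots> \<le> (\<Sum>s\<in>{t, Suc t}. \<Sum>i<ncom E s. resources E s i + \<kappa>)"
    by (intro sum_mono le) auto
  finally show False using slack by simp
qed

lemma gen_demand_nonneg:
  "p \<in> price_systems E \<Longrightarrow> 0 \<le> (\<Sum>h\<in>gen E t. demand E t h (p t) (p (Suc t)) s i)"
  by (intro sum_nonneg) (use demand_mem cons_setD(1) in blast)

lemma gen_excess_eq:
  "gen_excess E t p s i =
    (\<Sum>h\<in>gen E t. demand E t h (p t) (p (Suc t)) s i) - gen_resources E t s i"
  by (simp add: gen_excess_def gen_resources_def sum_subtractf)

text \<open>When both markets of its lifetime clear, a generation consumes at most total resources,
  since the other generation consumes a non-negative amount. Generation 0 is left out, as no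
  clearing is required in period 0.\<close>

lemma in_box_of_clearing:
  assumes p: "p \<in> price_systems E"
    and clear: "\<And>s i. s \<in> {t, Suc t} \<Longrightarrow> i < ncom E (Suc s) \<Longrightarrow>
      gen_excess E s p (Suc s) i + gen_excess E (Suc s) p (Suc s) i = 0"
  shows "in_box E \<sigma> (Suc t) p"
proof (rule in_box_of_feasible[OF p, where \<kappa> = 0])
  fix s i assume s: "s \<in> {Suc t, Suc (Suc t)}" and i: "i < ncom E s"
  then obtain u where u: "s = Suc u" "u \<in> {t, Suc t}" by auto
  show "(\<Sum>h\<in>gen E (Suc t). demand E (Suc t) h (p (Suc t)) (p (Suc (Suc t))) s i) \<le> resources E s i + 0"
    using clear[of u i] u i gen_demand_nonneg[OF p, of u s i] gen_demand_nonneg[OF p, of "Suc u" s i]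
    by (auto simp: gen_excess_eq resources_def)
qed (use supply_less[of "Suc t"] in simp)

lemma equilibriumD:
  assumes "p \<in> equilibria E \<sigma>"
  shows "p \<in> price_systems E" "p 0 0 = 1" "in_box E \<sigma> t p"
    "i < ncom E (Suc t) \<Longrightarrow> gen_excess E t p (Suc t) i + gen_excess E (Suc t) p (Suc t) i = 0"
proof -
  show p: "p \<in> price_systems E" and p0: "p 0 0 = 1"
    using assms by (auto simp: equilibria_def price_systems_def)
  have *: "gen_excess E t p (Suc t) i + gen_excess E (Suc t) p (Suc t) i = 0"
    if "i < ncom E (Suc t)" for t i
  proof -
    have "\<forall>t\<ge>1. \<forall>i<ncom E t. excess_demand E t (p (t - 1)) (p t) (p (Suc t)) i = 0"
      using assms by (simp add: equilibria_def)
    from this[rule_format, of "Suc t" i] that show ?thesis by (simp add: excess_demand_Suc)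
  qed
  then show "i < ncom E (Suc t) \<Longrightarrow> gen_excess E t p (Suc t) i + gen_excess E (Suc t) p (Suc t) i = 0" .
  show "in_box E \<sigma> t p"
  proof (cases t)
    case 0
    have "(p 0, p 1) \<in> price_box E 0 (\<sigma> 0)" using assms by (simp add: equilibria_def)
    then show ?thesis using p0 0 by (simp add: in_box_def)
  next
    case (Suc u)
    then show ?thesis using in_box_of_clearing[OF p] * by simp
  qed
qed

lemma nominal_savings_const:
  "p \<in> equilibria E \<sigma> \<Longrightarrow> nominal_savings E t p = nominal_savings E 0 p"
  by (induction t) (simp_all add: nominal_savings_Suc equilibriumD)

text \<open>Growth of the weight preserves the inequality that causes it, as savings stay constant.
  Only a window of \<open>n\<close> periods is assumed, so that truncated equilibria are covered as
  well.\<close>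

lemma young_weight_geometric:
  assumes p: "p \<in> price_systems E"
    and box: "\<And>k. k < n \<Longrightarrow> in_box E \<sigma> (t + k) p"
    and const: "\<And>k. k < n \<Longrightarrow> nominal_savings E (t + k) p = nominal_savings E t p"
    and le: "nominal_savings E t p \<le> \<delta> * young_weight E t p"
  shows "(1 + \<epsilon>) ^ n * young_weight E t p \<le> young_weight E (t + n) p"
  using box const
proof (induction n)
  case (Suc n)
  then have IH: "(1 + \<epsilon>) ^ n * young_weight E t p \<le> young_weight E (t + n) p" by simp
  have "1 * young_weight E t p \<le> (1 + \<epsilon>) ^ n * young_weight E t p"
    using eps young_weight_pos[OF p, of t] by (intro mult_right_mono one_le_power) auto
  then have "\<delta> * young_weight E t p \<le> \<delta> * young_weight E (t + n) p"
    using IH delta by (intro mult_left_mono) auto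
  then have "nominal_savings E (t + n) p \<le> \<delta> * young_weight E (t + n) p"
    using Suc.prems(2)[of n] le by simp
  then have "(1 + \<epsilon>) * young_weight E (t + n) p \<le> young_weight E (t + Suc n) p"
    using young_weight_growth[OF p Suc.prems(1)[of n]] by simp
  moreover have "(1 + \<epsilon>) * ((1 + \<epsilon>) ^ n * young_weight E t p) \<le> (1 + \<epsilon>) * young_weight E (t + n) p"
    using IH eps by (intro mult_left_mono) auto
  ultimately show ?case by (simp add: mult.assoc)
qed simp

text \<open>If the inequality fails once, the weights grow geometrically and the Cass series
  converges. If it always holds, the weights are bounded by nominal savings over \<delta>, so the
  terms of the series are bounded away from 0.\<close>

lemma Pareto_optimal_iff:
  assumes Cass: "generalized_Cass E \<sigma>" and p: "p \<in> equilibria E \<sigma>"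
  shows "p \<in> PO_equilibria E \<sigma> \<longleftrightarrow> (\<forall>t. \<delta> * young_weight E t p \<le> nominal_savings E t p)"
proof -
  let ?w = "\<lambda>t. young_weight E t p" and ?S = "nominal_savings E 0 p"
  note P = equilibriumD(1)[OF p]
  have w: "0 < ?w t" for t by (rule young_weight_pos[OF P])
  note const = nominal_savings_const[OF p]
  have PO: "p \<in> PO_equilibria E \<sigma> \<longleftrightarrow> filterlim (\<lambda>n. \<Sum>t\<le>n. 1 / ?w t) at_top sequentially"
    using Cass p unfolding generalized_Cass_def young_weight_def by blast
  show ?thesis
  proof
    assume PO': "p \<in> PO_equilibria E \<sigma>"
    show "\<forall>t. \<delta> * ?w t \<le> nominal_savings E t p"
    proof (rule ccontr)
      assume "\<not> ?thesis"
      then obtain t where "nominal_savings E t p < \<delta> * ?w t" by (auto simp: not_le)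
      then have t: "nominal_savings E t p \<le> \<delta> * ?w t" by simp
      have geo: "(1 + \<epsilon>) ^ n * ?w t \<le> ?w (t + n)" for n
        using equilibriumD(3)[OF p] const[of t] const[of "t + _"] t
        by (intro young_weight_geometric[OF P]) simp_all
      have "summable (\<lambda>n. 1 / ?w (n + t))"
      proof (rule summable_comparison_test')
        show "summable (\<lambda>n. (1 / ?w t) * (1 / (1 + \<epsilon>)) ^ n)"
          using eps by (intro summable_mult summable_geometric) simp
        fix n :: nat
        have "1 / ?w (t + n) \<le> 1 / ((1 + \<epsilon>) ^ n * ?w t)"
          using geo[of n] w eps by (intro divide_left_mono mult_pos_pos) auto
        then show "norm (1 / ?w (n + t)) \<le> (1 / ?w t) * (1 / (1 + \<epsilon>)) ^ n"
          using w by (simp add: add.commute less_imp_le power_one_over field_simps)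
      qed
      then have "summable (\<lambda>n. 1 / ?w n)" by (rule summable_iff_shift[where f = "\<lambda>n. 1 / ?w n", THEN iffD1])
      then have "(\<lambda>n. \<Sum>t\<le>n. 1 / ?w t) \<longlonglongrightarrow> (\<Sum>n. 1 / ?w n)"
        by (rule summable_LIMSEQ')
      then show False
        using PO PO' not_tendsto_and_filterlim_at_infinity filterlim_at_top_imp_at_infinity
          trivial_limit_sequentially by blast
    qed
  next
    assume *: "\<forall>t. \<delta> * ?w t \<le> nominal_savings E t p"
    then have le: "\<delta> * ?w t \<le> ?S" for t using const[of t] by metis
    then have S: "0 < ?S" using w[of 0] delta by (metis less_le_trans mult_pos_pos)
    have "\<delta> / ?S \<le> 1 / ?w t" for t using le[of t] S w[of t] delta by (simp add: field_simps)
    then have "(\<Sum>t\<le>n. \<delta> / ?S) \<le> (\<Sum>t\<le>n. 1 / ?w t)" for n by (intro sum_mono)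
    then have "real (Suc n) * (\<delta> / ?S) \<le> (\<Sum>t\<le>n. 1 / ?w t)" for n by simp
    moreover have "real n * (\<delta> / ?S) \<le> real (Suc n) * (\<delta> / ?S)" for n
      using delta S by (intro mult_right_mono) auto
    ultimately have ge: "real n * (\<delta> / ?S) \<le> (\<Sum>t\<le>n. 1 / ?w t)" for n by (rule order_trans[rotated])
    have "filterlim (\<lambda>n. real n * (\<delta> / ?S)) at_top sequentially"
      using delta S by (intro filterlim_at_top_mult_tendsto_pos[OF tendsto_const _ filterlim_real_sequentially]) simp
    then show "p \<in> PO_equilibria E \<sigma>"
      unfolding PO by (rule filterlim_at_top_mono) (use ge in auto)
  qed
qed

text \<open>Equality in period 0 would force the weight to grow by the factor
  \<open>1 + \<epsilon>\<close>, and the inequality would fail in period 1.\<close>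

lemma savings_gt_delta:
  assumes p: "p \<in> equilibria E \<sigma>" and le: "\<And>t. \<delta> * young_weight E t p \<le> nominal_savings E t p"
  shows "(\<Sum>h\<in>gen E 0. savings E 0 h (p 0) (p 1)) / gen_endow E 0 0 > \<delta>"
proof -
  note P = equilibriumD(1)[OF p]
  have "\<delta> * young_weight E 0 p < nominal_savings E 0 p"
  proof (rule ccontr)
    assume "\<not> ?thesis"
    then have S: "nominal_savings E 0 p \<le> \<delta> * young_weight E 0 p" by simp
    have "\<delta> * ((1 + \<epsilon>) * young_weight E 0 p) \<le> \<delta> * young_weight E (Suc 0) p"
      using young_weight_growth[OF P equilibriumD(3)[OF p] S] delta by (intro mult_left_mono) auto
    also have "\<dots> \<le> \<delta> * young_weight E 0 p"
      using le[of "Suc 0"] S nominal_savings_const[OF p, of "Suc 0"] by simp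
    finally show False
      using mult_pos_pos[OF delta mult_pos_pos[OF eps young_weight_pos[OF P, of 0]]]
      by (simp add: algebra_simps)
  qed
  then show ?thesis
    using young_weight_pos[OF P, of 0] sum_savings[of 0 p]
    by (simp add: young_weight_def pos_less_divide_eq)
qed

end

subsection \<open>Truncated economies\<close>

context olg begin

text \<open>The truncated economy consists of the generations up to \<open>T\<close>, supplemented
  by the endowment of generation \<open>Suc T\<close> when young; its total supply equals that of
  the original economy in each period up to \<open>Suc T\<close>.\<close>

lemma resources_finite_sum:
  assumes "s \<le> Suc T"
  shows "(\<Sum>t\<le>T. gen_resources E t s i) + (if s = Suc T then gen_resources E (Suc T) s i else 0) =
    resources E s i"
proof -
  have "resources E s i = (\<Sum>t\<le>Suc T. gen_resources E t s i)"
    unfolding resources_def using assms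
    by (intro sum.mono_neutral_left) (auto intro!: gen_resources_zero)
  then show ?thesis using assms gen_resources_zero[of s "Suc T" i] by simp
qed

end

section \<open>A priori price bounds and existence with finite horizon\<close>

context prone_olg begin

text \<open>From one numeraire to the next, prices change by a factor between
  \<open>\<sigma> t\<close> and its inverse, so with \<open>p 0 0 = 1\<close> the numeraire price of
  period \<open>t\<close> lies between \<open>lower t\<close> and its inverse. Other commodities of
  that period cost one more factor, whence \<open>lower (Suc t)\<close>.\<close>

definition lower :: "nat \<Rightarrow> real" where
  "lower t = (\<Prod>s<t. \<sigma> s)"

lemma lower_0: "lower 0 = 1" and lower_Suc: "lower (Suc t) = lower t * \<sigma> t"
  by (simp_all add: lower_def)

lemma lower_pos: "0 < lower t"
  unfolding lower_def by (intro prod_pos ballI sigma_pos)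

lemma lower_antimono: "s \<le> t \<Longrightarrow> lower t \<le> lower s"
proof (rule lift_Suc_antimono_le[of lower])
  show "lower (Suc n) \<le> lower n" for n
    using lower_pos[of n] sigma_less[of n] by (simp add: lower_Suc mult_left_le)
qed

lemma price_bounds:
  assumes p: "p \<in> price_systems E" "p 0 0 = 1" and box: "\<And>t. t \<le> T \<Longrightarrow> in_box E \<sigma> t p"
    and s: "s \<le> Suc T" and i: "i < ncom E s"
  shows "lower (Suc s) \<le> p s i" "lower (Suc s) * p s i \<le> 1"
proof -
  have B: "\<sigma> t * p t 0 \<le> p s i \<and> \<sigma> t * p s i \<le> p t 0"
    if "t \<le> T" "s = t \<or> s = Suc t" "i < ncom E s" for t s i
    using box[OF that(1)] that(2,3) in_box_iff[of p E t \<sigma>, OF p(1) ncom_pos sigma_pos] by blast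
  have num: "lower t \<le> p t 0 \<and> lower t * p t 0 \<le> 1" if "t \<le> Suc T" for t
    using that
  proof (induction t)
    case 0
    then show ?case using p(2) by (simp add: lower_0)
  next
    case (Suc t)
    then have IH: "lower t \<le> p t 0" "lower t * p t 0 \<le> 1" and b: "\<sigma> t * p t 0 \<le> p (Suc t) 0"
      "\<sigma> t * p (Suc t) 0 \<le> p t 0"
      using B[of t "Suc t" 0] ncom_pos by auto
    have "lower t * \<sigma> t \<le> \<sigma> t * p t 0" using IH(1) sigma_pos[of t] by (simp add: mult.commute)
    moreover have "lower t * (\<sigma> t * p (Suc t) 0) \<le> lower t * p t 0"
      using b(2) lower_pos[of t] by (intro mult_left_mono) auto
    ultimately show ?case using IH(2) b(1) by (simp add: lower_Suc mult.assoc)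
  qed
  have step: "lower (Suc t) \<le> p s i \<and> lower (Suc t) * p s i \<le> 1"
    if t: "t \<le> T" and s: "s = t \<or> s = Suc t" "i < ncom E s" for t s i
  proof -
    have nt: "lower t \<le> p t 0" "lower t * p t 0 \<le> 1" using num[of t] t by auto
    note b = B[OF t s]
    have "lower t * \<sigma> t \<le> \<sigma> t * p t 0" using nt(1) sigma_pos[of t] by (simp add: mult.commute)
    moreover have "lower t * (\<sigma> t * p s i) \<le> lower t * p t 0"
      using b lower_pos[of t] by (intro mult_left_mono) auto
    ultimately show ?thesis using nt(2) b by (simp add: lower_Suc mult.assoc)
  qed
  show "lower (Suc s) \<le> p s i" "lower (Suc s) * p s i \<le> 1"
  proof -
    have pos: "0 < p s i" using price_systemsD(2)[OF p(1) i] .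
    have "lower (Suc s) \<le> p s i \<and> lower (Suc s) * p s i \<le> 1"
    proof (cases "s = Suc T")
      \<comment> \<open>Period \<open>Suc T\<close> is controlled only through the box of
        \<open>T\<close>; the bound is weakened to a form that depends on the period alone.\<close>
      case True
      have "lower (Suc s) \<le> lower (Suc T)" by (intro lower_antimono) (simp add: True)
      moreover from this have "lower (Suc s) * p s i \<le> lower (Suc T) * p s i"
        using pos by (intro mult_right_mono) auto
      ultimately show ?thesis using step[of T s i] True i by simp
    next
      case False
      then show ?thesis using step[of s s i] s i by simp
    qed
    then show "lower (Suc s) \<le> p s i" "lower (Suc s) * p s i \<le> 1" by auto
  qed
qed

lemma gen_excess_zero:
  "p \<in> price_systems E \<Longrightarrow> s \<noteq> t \<Longrightarrow> s \<noteq> Suc t \<Longrightarrow> gen_excess E t p s i = 0"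
  unfolding gen_excess_def using cons_setD(2)[OF demand_mem] cons_setD(2)[OF endow_mem]
  by (intro sum.neutral ballI) simp

text \<open>The additional household spends its income \<open>inc p\<close> on equal amounts of all commodities of period
  \<open>0\<close>.  Complementarity on a large cube of prices bounds the excess demand \<open>Z\<close> from above by \<open>\<kappa>\<close>; the
  border condition then keeps the prices away from the faces of the cube, so that \<open>Z = 0\<close>.\<close>

lemma truncated_equilibrium:
  obtains p where "p \<in> price_systems E" "p 0 0 = 1" "\<And>t. t \<le> T \<Longrightarrow> in_box E \<sigma> t p"
    "\<And>s i. s < T \<Longrightarrow> i < ncom E (Suc s) \<Longrightarrow>
       gen_excess E s p (Suc s) i + gen_excess E (Suc s) p (Suc s) i = 0"
    "nominal_savings E T p = (\<Sum>i<ncom E (Suc T). p (Suc T) i * gen_resources E (Suc T) (Suc T) i)"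
    "\<And>s i. Suc T < s \<Longrightarrow> i < ncom E s \<Longrightarrow> p s i = 1"
proof -
  define I where "I = Sigma {..Suc T} (\<lambda>s. {..<ncom E s})"
  have finI: "finite I" by (simp add: I_def)
  have I00: "(0, 0) \<in> I" using ncom_pos by (simp add: I_def)
  define M where "M = (\<Sum>(s, i)\<in>I. resources E s i)"
  have res0: "0 \<le> resources E s i" for s i
    unfolding resources_def by (intro sum_nonneg gen_resources_nonneg)
  have M0: "0 \<le> M" unfolding M_def using res0 by (intro sum_nonneg) auto
  \<comment> \<open>The gap in \<open>supply_less\<close>, shared equally among the commodities of
    the two periods.\<close>
  define slack where "slack t = (beta amin amax * (\<Sum>h\<in>gen E t. bundle_norm E t (endow E h)) -
    (\<Sum>s\<in>{t, Suc t}. \<Sum>i<ncom E s. resources E s i)) / (real (ncom E t) + real (ncom E (Suc t)))" for t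
  have slack_pos: "0 < slack t" for t
    unfolding slack_def using supply_less[of t] ncom_pos[of t] by (intro divide_pos_pos) auto
  define \<kappa> where "\<kappa> = Min (slack ` {..T})"
  have \<kappa>: "0 < \<kappa>" "\<And>t. t \<le> T \<Longrightarrow> \<kappa> \<le> slack t"
    unfolding \<kappa>_def using slack_pos by auto
  \<comment> \<open>The first term puts the faces of the cube outside the a priori price bounds; the
    second ensures \<open>\<eta> * M \<le> \<kappa>\<close>, with \<open>M + 1\<close> avoiding a
    zero denominator.\<close>
  define \<eta> where "\<eta> = min (lower (Suc (Suc T)) / 2) (\<kappa> / (M + 1))"
  have \<eta>: "0 < \<eta>" "\<eta> < lower (Suc (Suc T))" "\<eta> * M \<le> \<kappa>" "\<eta> \<le> 1"
  proof -
    show "0 < \<eta>" unfolding \<eta>_def using lower_pos \<kappa>(1) M0 by simp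
    show l: "\<eta> < lower (Suc (Suc T))" unfolding \<eta>_def using lower_pos[of "Suc (Suc T)"] by linarith
    show "\<eta> \<le> 1" using l lower_antimono[of 0 "Suc (Suc T)"] by (simp add: lower_0)
    have "\<eta> * M \<le> \<kappa> / (M + 1) * (M + 1)"
      unfolding \<eta>_def using M0 \<kappa>(1) by (intro mult_mono) auto
    then show "\<eta> * M \<le> \<kappa>" using M0 by simp
  qed
  \<comment> \<open>Pinning the numeraire normalizes prices. Prices after \<open>Suc T\<close> do
    not enter the truncated markets and are set to 1.\<close>
  define fixed where "fixed s i \<longleftrightarrow> s = 0 \<and> i = 0 \<or> Suc T < s" for s i :: nat
  define lo where "lo s i = (if i < ncom E s then if fixed s i then 1 else \<eta> else 0)" for s i
  define hi where "hi s i = (if i < ncom E s then if fixed s i then 1 else 1 / \<eta> else 0)" for s i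
  have lohi: "lo s i \<le> hi s i" for s i
    using \<eta> by (simp add: lo_def hi_def le_divide_eq mult_le_one)
  have box_ps: "p \<in> price_systems E" if p: "\<And>s i. lo s i \<le> p s i \<and> p s i \<le> hi s i" for p
  proof -
    have "0 < p s i" if i: "i < ncom E s" for s i
      using i p[of s i] \<eta>(1)
      by (auto simp: lo_def split: if_splits)
    moreover have "p s i = 0" if "ncom E s \<le> i" for s i
      using that p[of s i]
      by (simp add: lo_def hi_def)
    ultimately show ?thesis by (simp add: price_systems_def pos_vec_def)
  qed
  define b where "b = gen_resources E (Suc T) (Suc T)"
  define inc where "inc p = (\<Sum>i<ncom E (Suc T). p (Suc T) i * b i)" for p :: "nat \<Rightarrow> nat \<Rightarrow> real"
  \<comment> \<open>The last two terms are the demand and the endowment of the additional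
    household.\<close>
  define Z where "Z p s i = (\<Sum>t\<le>T. gen_excess E t p s i) +
    (if s = 0 then inc p / norm1 (ncom E 0) (p 0) else 0) - (if s = Suc T then b i else 0)" for p s i
  have Zcont: "continuous_on {p. \<forall>s i. lo s i \<le> p s i \<and> p s i \<le> hi s i} (\<lambda>p. Z p s i)" for s i
  proof (rule continuous_on_subset[of "price_systems E"])
    have "norm1 (ncom E 0) (p 0) \<noteq> 0" if "p \<in> price_systems E" for p
      using norm1_pos[OF that, of 0] by simp
    moreover have "continuous_on (price_systems E) (\<lambda>p. norm1 (ncom E 0) (p 0))"
      unfolding norm1_def by (intro continuous_intros)
    moreover have "continuous_on (price_systems E) inc"
      unfolding inc_def by (intro continuous_intros)
    ultimately have "continuous_on (price_systems E) (\<lambda>p. inc p / norm1 (ncom E 0) (p 0))"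
      by (intro continuous_on_divide) auto
    then show "continuous_on (price_systems E) (\<lambda>p. Z p s i)"
      unfolding Z_def by (cases "s = 0")
        (simp_all add: continuous_on_add continuous_on_diff continuous_on_sum continuous_on_gen_excess)
    show "{p. \<forall>s i. lo s i \<le> p s i \<and> p s i \<le> hi s i} \<subseteq> price_systems E" using box_ps by blast
  qed
  have inc_nonneg: "0 \<le> inc p" if "p \<in> price_systems E" for p
    unfolding inc_def b_def using price_systemsD(2)[OF that] gen_resources_nonneg
    by (intro sum_nonneg mult_nonneg_nonneg) (auto intro: less_imp_le)
  have Walras: "(\<Sum>(s, i)\<in>I. p s i * Z p s i) = 0" if p: "p \<in> price_systems E" for p
  proof -
    have gb: "(\<Sum>s\<le>Suc T. \<Sum>i<ncom E s. p s i * gen_excess E t p s i) = 0" if "t \<le> T" for t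
    proof -
      have "(\<Sum>s\<le>Suc T. \<Sum>i<ncom E s. p s i * gen_excess E t p s i) =
          (\<Sum>s\<in>{t, Suc t}. \<Sum>i<ncom E s. p s i * gen_excess E t p s i)"
        using that by (intro sum.mono_neutral_right) (auto simp: gen_excess_zero[OF p])
      then show ?thesis using generation_budget[OF p, of t] by simp
    qed
    have "(\<Sum>s\<le>Suc T. \<Sum>i<ncom E s. p s i * (\<Sum>t\<le>T. gen_excess E t p s i)) =
        (\<Sum>s\<le>Suc T. \<Sum>t\<le>T. \<Sum>i<ncom E s. p s i * gen_excess E t p s i)"
      unfolding sum_distrib_left by (intro sum.cong refl sum.swap)
    also have "\<dots> = (\<Sum>t\<le>T. \<Sum>s\<le>Suc T. \<Sum>i<ncom E s. p s i * gen_excess E t p s i)"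
      by (rule sum.swap)
    also have "\<dots> = 0" using gb by (intro sum.neutral) auto
    finally have 1: "(\<Sum>s\<le>Suc T. \<Sum>i<ncom E s. p s i * (\<Sum>t\<le>T. gen_excess E t p s i)) = 0" .
    have n0: "norm1 (ncom E 0) (p 0) = (\<Sum>i<ncom E 0. p 0 i)"
      using price_systemsD(2)[OF p] by (intro norm1_nonneg_eq) (auto intro: less_imp_le)
    have "(\<Sum>s\<le>Suc T. \<Sum>i<ncom E s. p s i * (if s = 0 then inc p / norm1 (ncom E 0) (p 0) else 0)) =
        (\<Sum>s\<in>{0}. \<Sum>i<ncom E s. p s i * (inc p / norm1 (ncom E 0) (p 0)))"
      by (intro sum.mono_neutral_cong_right) auto
    also have "\<dots> = (\<Sum>i<ncom E 0. p 0 i) * (inc p / norm1 (ncom E 0) (p 0))"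
      by (simp add: sum_distrib_right sum_divide_distrib)
    also have "\<dots> = inc p" using norm1_pos[OF p, of 0] unfolding n0[symmetric] by simp
    finally have 2: "(\<Sum>s\<le>Suc T. \<Sum>i<ncom E s.
        p s i * (if s = 0 then inc p / norm1 (ncom E 0) (p 0) else 0)) = inc p" .
    have 3: "(\<Sum>s\<le>Suc T. \<Sum>i<ncom E s. p s i * (if s = Suc T then b i else 0)) = inc p"
    proof -
      have "(\<Sum>s\<le>Suc T. \<Sum>i<ncom E s. p s i * (if s = Suc T then b i else 0)) =
          (\<Sum>s\<in>{Suc T}. \<Sum>i<ncom E s. p s i * b i)"
        by (intro sum.mono_neutral_cong_right) auto
      then show ?thesis by (simp add: inc_def)
    qed
    have "(\<Sum>(s, i)\<in>I. p s i * Z p s i) = (\<Sum>s\<le>Suc T. \<Sum>i<ncom E s. p s i * Z p s i)"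
      unfolding I_def by (rule sum.Sigma[symmetric]) auto
    also have "\<dots> = 0"
      unfolding Z_def distrib_left right_diff_distrib sum.distrib sum_subtractf 1 2 3 by simp
    finally show ?thesis .
  qed
  have Zlower: "- resources E s i \<le> Z p s i" if p: "p \<in> price_systems E" and s: "s \<le> Suc T" for p s i
  proof -
    have "- gen_resources E t s i \<le> gen_excess E t p s i" for t
      using gen_demand_nonneg[OF p, of t s i] by (simp add: gen_excess_eq)
    then have "(\<Sum>t\<le>T. - gen_resources E t s i) \<le> (\<Sum>t\<le>T. gen_excess E t p s i)"
      by (rule sum_mono)
    moreover have "0 \<le> inc p / norm1 (ncom E 0) (p 0)"
      using inc_nonneg[OF p] norm1_pos[OF p, of 0] by simp
    ultimately show ?thesis
      using resources_finite_sum[OF s, of i] unfolding Z_def b_def by (auto simp: sum_negf split: if_splits)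
  qed
  obtain p where p: "\<And>s i. lo s i \<le> p s i \<and> p s i \<le> hi s i"
    and hi: "\<And>s i. (s, i) \<in> I \<Longrightarrow> 0 < Z p s i \<Longrightarrow> p s i = hi s i"
    and lo: "\<And>s i. (s, i) \<in> I \<Longrightarrow> Z p s i < 0 \<Longrightarrow> p s i = lo s i"
    using box_complementarity[OF finI, of lo hi Z] lohi Zcont by blast
  note P = box_ps[OF p]
  have p1: "p s i = 1" if "fixed s i" "i < ncom E s" for s i
    using p[of s i] that by (simp add: lo_def hi_def)
  then have p00: "p 0 0 = 1" using ncom_pos by (simp add: fixed_def)
  define J where "J = I - {(0, 0)}"
  have J: "(s, i) \<in> I \<and> \<not> fixed s i" if "(s, i) \<in> J" for s i
    using that by (auto simp: J_def I_def fixed_def)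
  have splitI: "Z p 0 0 + (\<Sum>(s, i)\<in>J. p s i * Z p s i) = 0"
    using Walras[OF P] sum.remove[OF finI I00, of "\<lambda>(s, i). p s i * Z p s i"] p00
    by (simp add: J_def)
  \<comment> \<open>Negative \<open>Z\<close> occurs only at the floor price \<open>\<eta>\<close>,
    and excess supply never exceeds resources.\<close>
  have low: "- (\<eta> * resources E s i) \<le> p s i * Z p s i" if "(s, i) \<in> J" for s i
  proof (cases "Z p s i < 0")
    case True
    have "p s i = \<eta>" using lo[OF _ True] J[OF that] by (auto simp: lo_def I_def)
    then show ?thesis
      using Zlower[OF P, of s i] J[OF that] \<eta>(1) by (simp add: I_def)
        (metis minus_mult_right mult_left_mono less_imp_le)
  next
    case False
    then have "0 \<le> p s i * Z p s i" using price_systemsD(2)[OF P, of i s] J[OF that] by (simp add: I_def)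
    moreover have "0 \<le> \<eta> * resources E s i" using res0 \<eta>(1) by simp
    ultimately show ?thesis by linarith
  qed
  have low': "- resources E s i \<le> p s i * Z p s i" if "(s, i) \<in> I" for s i
  proof (cases "(s, i) = (0, 0)")
    case True
    then show ?thesis using Zlower[OF P, of 0 0] p00 by simp
  next
    case False
    have "\<eta> * resources E s i \<le> resources E s i" using \<eta> res0 by (simp add: mult_left_le_one_le)
    then show ?thesis using low[of s i] that False by (simp add: J_def)
  qed
  \<comment> \<open>For the numeraire, Walras' law balances \<open>Z\<close> against the terms
    bounded by \<open>low\<close>. Any other commodity with \<open>Z > \<kappa>\<close> would have
    price \<open>1 / \<eta>\<close>, and Walras' law with \<open>low'\<close> would give
    \<open>Z \<le> \<eta> * M\<close>.\<close>
  have Zupper: "Z p s i \<le> \<kappa>" if si: "(s, i) \<in> I" for s i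
  proof (cases "(s, i) = (0, 0)")
    case True
    have "(\<Sum>(s, i)\<in>J. - (\<eta> * resources E s i)) \<le> (\<Sum>(s, i)\<in>J. p s i * Z p s i)"
      using low by (intro sum_mono) auto
    moreover have "(\<Sum>(s, i)\<in>J. - (\<eta> * resources E s i)) = - (\<eta> * (\<Sum>(s, i)\<in>J. resources E s i))"
      by (simp add: sum_distrib_left sum_negf split_def)
    moreover have "(\<Sum>(s, i)\<in>J. resources E s i) \<le> M"
      unfolding M_def J_def using res0 finI by (intro sum_mono2) auto
    then have "\<eta> * (\<Sum>(s, i)\<in>J. resources E s i) \<le> \<eta> * M"
      using \<eta>(1) by (intro mult_left_mono) auto
    ultimately show ?thesis using splitI \<eta>(3) True by simp
  next
    case False
    show ?thesis
    proof (rule ccontr)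
      assume "\<not> ?thesis"
      then have Z: "\<kappa> < Z p s i" by simp
      then have "p s i = 1 / \<eta>"
        using hi[OF si] \<kappa>(1) J[of s i] si False by (simp add: J_def hi_def I_def)
      then have "p s i * Z p s i = Z p s i / \<eta>" by simp
      moreover have "p s i * Z p s i + (\<Sum>(s, i)\<in>I - {(s, i)}. p s i * Z p s i) = 0"
        using Walras[OF P] sum.remove[OF finI si, of "\<lambda>(s, i). p s i * Z p s i"] by simp
      moreover have "(\<Sum>(s, i)\<in>I - {(s, i)}. - resources E s i) \<le> (\<Sum>(s, i)\<in>I - {(s, i)}. p s i * Z p s i)"
        using low' by (intro sum_mono) auto
      moreover have "(\<Sum>(s, i)\<in>I - {(s, i)}. resources E s i) \<le> M"
        unfolding M_def using res0 finI by (intro sum_mono2) auto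
      moreover have "(\<Sum>(s, i)\<in>I - {(s, i)}. - resources E s i) = - (\<Sum>(s, i)\<in>I - {(s, i)}. resources E s i)"
        by (simp add: sum_negf split_def)
      ultimately have "Z p s i / \<eta> \<le> M" by linarith
      then have "Z p s i \<le> \<eta> * M" using \<eta>(1) by (simp add: field_simps)
      then show False using Z \<eta>(3) by simp
    qed
  qed
  have box: "in_box E \<sigma> t p" if t: "t \<le> T" for t
  proof (rule in_box_of_feasible[OF P])
    fix s i assume s: "s \<in> {t, Suc t}" and i: "i < ncom E s"
    then have sT: "s \<le> Suc T" and si: "(s, i) \<in> I" using t by (auto simp: I_def)
    have "(\<Sum>h\<in>gen E t. demand E t h (p t) (p (Suc t)) s i)
        \<le> (\<Sum>u\<le>T. \<Sum>h\<in>gen E u. demand E u h (p u) (p (Suc u)) s i)"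
      using t gen_demand_nonneg[OF P] by (intro member_le_sum) auto
    also have "\<dots> = (\<Sum>u\<le>T. gen_excess E u p s i) + (\<Sum>u\<le>T. gen_resources E u s i)"
      by (simp add: gen_excess_eq sum.distrib[symmetric])
    also have "\<dots> \<le> Z p s i + resources E s i"
    proof -
      have "0 \<le> inc p / norm1 (ncom E 0) (p 0)"
        using inc_nonneg[OF P] norm1_pos[OF P, of 0] by simp
      then show ?thesis
        using resources_finite_sum[OF sT, of i] unfolding Z_def b_def by (auto split: if_splits)
    qed
    finally show "(\<Sum>h\<in>gen E t. demand E t h (p t) (p (Suc t)) s i) \<le> resources E s i + \<kappa>"
      using Zupper[OF si] by simp
  next
    have n: "0 < real (ncom E t) + real (ncom E (Suc t))" using ncom_pos[of t] by simp
    have "(\<Sum>s\<in>{t, Suc t}. \<Sum>i<ncom E s. resources E s i + \<kappa>) =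
        (\<Sum>s\<in>{t, Suc t}. \<Sum>i<ncom E s. resources E s i) + \<kappa> * (real (ncom E t) + real (ncom E (Suc t)))"
      by (simp add: sum.distrib algebra_simps)
    then show "(\<Sum>s\<in>{t, Suc t}. \<Sum>i<ncom E s. resources E s i + \<kappa>) \<le>
        beta amin amax * (\<Sum>h\<in>gen E t. bundle_norm E t (endow E h))"
      using \<kappa>(2)[OF t] unfolding slack_def pos_le_divide_eq[OF n] by simp
  qed
  \<comment> \<open>The bounds implied by the boxes place the price strictly between
    \<open>\<eta>\<close> and \<open>1 / \<eta>\<close>, so complementarity excludes both signs of
    \<open>Z\<close>.\<close>
  have ZJ: "Z p s i = 0" if "(s, i) \<in> J" for s i
  proof -
    have s: "s \<le> Suc T" and i: "i < ncom E s" using J[OF that] by (auto simp: I_def)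
    note b = price_bounds[OF P p00 box s i]
    have "lower (Suc (Suc T)) \<le> lower (Suc s)" using s by (intro lower_antimono) simp
    then have l: "\<eta> < lower (Suc s)" using \<eta>(2) by simp
    have pos: "0 < p s i" using price_systemsD(2)[OF P i] .
    have "\<eta> < p s i" using l b(1) by simp
    moreover have "\<eta> * p s i < 1" using l b(2) pos by (metis less_le_trans mult_strict_right_mono)
    then have "p s i < 1 / \<eta>" using \<eta>(1) by (simp add: field_simps)
    ultimately show ?thesis
      using hi[of s i] lo[of s i] J[OF that] i by (simp add: lo_def hi_def) (metis linorder_less_linear)
  qed
  \<comment> \<open>The numeraire market has a fixed price and clears by Walras' law.\<close>
  then have Z0: "Z p s i = 0" if "s \<le> Suc T" "i < ncom E s" for s i
  proof -
    have "(\<Sum>(s, i)\<in>J. p s i * Z p s i) = 0" using ZJ by (intro sum.neutral) auto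
    then have "Z p 0 0 = 0" using splitI by simp
    moreover have "(s, i) \<in> J \<or> (s, i) = (0, 0)" using that by (auto simp: J_def I_def)
    ultimately show ?thesis using ZJ by blast
  qed
  show ?thesis
  proof
    show "p \<in> price_systems E" by (rule P)
    show "p 0 0 = 1" by (rule p00)
    show "in_box E \<sigma> t p" if "t \<le> T" for t using box[OF that] .
    show "gen_excess E s p (Suc s) i + gen_excess E (Suc s) p (Suc s) i = 0"
      if "s < T" "i < ncom E (Suc s)" for s i
    proof -
      have "(\<Sum>t\<le>T. gen_excess E t p (Suc s) i) = (\<Sum>t\<in>{s, Suc s}. gen_excess E t p (Suc s) i)"
        using that by (intro sum.mono_neutral_right) (auto intro!: gen_excess_zero[OF P])
      then show ?thesis using Z0[of "Suc s" i] that by (simp add: Z_def)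
    qed
    show "nominal_savings E T p = (\<Sum>i<ncom E (Suc T). p (Suc T) i * gen_resources E (Suc T) (Suc T) i)"
      unfolding nominal_savings_old[OF P]
    proof (intro sum.cong refl)
      fix i assume "i \<in> {..<ncom E (Suc T)}"
      then have "Z p (Suc T) i = 0" by (intro Z0) auto
      moreover have "(\<Sum>t\<le>T. gen_excess E t p (Suc T) i) = (\<Sum>t\<in>{T}. gen_excess E t p (Suc T) i)"
        by (intro sum.mono_neutral_right) (auto intro!: gen_excess_zero[OF P])
      ultimately show "p (Suc T) i * gen_excess E T p (Suc T) i =
          p (Suc T) i * gen_resources E (Suc T) (Suc T) i"
        by (simp add: Z_def b_def)
    qed
    show "p s i = 1" if "Suc T < s" "i < ncom E s" for s i
      using p1[of s i] that by (simp add: fixed_def)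
  qed
qed

end

subsection \<open>Compactness and existence\<close>

context prone_olg begin

text \<open>The bounds do not involve a horizon, so one compact set contains all equilibria and all
  truncated equilibria constructed above.\<close>

definition price_cube :: "(nat \<Rightarrow> nat \<Rightarrow> real) set" where
  "price_cube = {p. \<forall>s i. (if i < ncom E s then lower (Suc s) else 0) \<le> p s i \<and>
     p s i \<le> (if i < ncom E s then 1 / lower (Suc s) else 0)}"

text \<open>The conditions for a Pareto optimal equilibrium checked up to horizon \<open>m\<close>,
  with optimality expressed through savings. The sets are closed and decrease in
  \<open>m\<close>.\<close>

definition initial_PO :: "nat \<Rightarrow> (nat \<Rightarrow> nat \<Rightarrow> real) set" where
  "initial_PO m = {p \<in> price_cube. p 0 0 = 1 \<and> in_box E \<sigma> 0 p \<and>
     (\<forall>s<m. \<forall>i<ncom E (Suc s).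
        gen_excess E s p (Suc s) i + gen_excess E (Suc s) p (Suc s) i = 0) \<and>
     (\<forall>t\<le>m. \<delta> * young_weight E t p \<le> nominal_savings E t p)}"

lemma compact_price_cube: "compact price_cube"
  unfolding price_cube_def by (rule compact_box2)

lemma price_cubeD:
  "p \<in> price_cube \<Longrightarrow> (if i < ncom E s then lower (Suc s) else 0) \<le> p s i \<and>
     p s i \<le> (if i < ncom E s then 1 / lower (Suc s) else 0)"
  by (simp add: price_cube_def)

lemma price_cube_subset: "price_cube \<subseteq> price_systems E"
proof
  fix p assume p: "p \<in> price_cube"
  have "0 < p s i" if "i < ncom E s" for s i
  proof -
    have "lower (Suc s) \<le> p s i" using price_cubeD[OF p, of i s] that by simp
    then show ?thesis using lower_pos[of "Suc s"] by linarith
  qed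
  moreover have "p s i = 0" if "ncom E s \<le> i" for s i
  proof -
    have "0 \<le> p s i \<and> p s i \<le> 0" using price_cubeD[OF p, of i s] that by simp
    then show ?thesis by simp
  qed
  ultimately show "p \<in> price_systems E" by (simp add: price_systems_def pos_vec_def)
qed

lemma mem_price_cubeI:
  assumes "p \<in> price_systems E"
    "\<And>s i. i < ncom E s \<Longrightarrow> lower (Suc s) \<le> p s i \<and> lower (Suc s) * p s i \<le> 1"
  shows "p \<in> price_cube"
proof -
  have "p s i = 0" if "ncom E s \<le> i" for s i
    using price_systemsD(1)[OF assms(1), of s] that by (simp add: pos_vec_def)
  moreover have "p s i \<le> 1 / lower (Suc s)" if "i < ncom E s" for s i
    using assms(2)[OF that] lower_pos[of "Suc s"] by (simp add: field_simps)
  ultimately show ?thesis using assms(2) by (auto simp: price_cube_def)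
qed

text \<open>Demand is continuous only at positive prices, but the closed cube stays within that
  domain.\<close>

lemma closed_initial_PO: "closed (initial_PO m)"
proof -
  have clK: "closed price_cube" using compact_price_cube by (rule compact_imp_closed)
  have le: "closed {p \<in> price_cube. f p \<le> g p}"
    if "continuous_on (price_systems E) f" "continuous_on (price_systems E) g"
    for f g :: "(nat \<Rightarrow> nat \<Rightarrow> real) \<Rightarrow> real"
    using that continuous_on_subset[OF _ price_cube_subset] clK
    by (intro continuous_on_closed_Collect_le) auto
  have eq: "closed {p \<in> price_cube. f p = c}"
    if "continuous_on (price_systems E) f" for f :: "(nat \<Rightarrow> nat \<Rightarrow> real) \<Rightarrow> real" and c
  proof -
    have "{p \<in> price_cube. f p = c} = {p \<in> price_cube. f p \<le> c} \<inter> {p \<in> price_cube. c \<le> f p}"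
      by auto
    then show ?thesis
      by (simp only:) (intro closed_Int le that continuous_on_const)
  qed
  have "closed {p \<in> price_cube. in_box E \<sigma> 0 p}"
  proof -
    have box: "in_box E \<sigma> 0 p \<longleftrightarrow> (\<forall>s\<in>{0, Suc 0}. \<forall>i<ncom E s.
        \<sigma> 0 * p 0 0 \<le> p s i \<and> \<sigma> 0 * p s i \<le> p 0 0)" if "p \<in> price_cube" for p
      using in_box_iff[of p E 0 \<sigma>, OF subsetD[OF price_cube_subset that] ncom_pos sigma_pos] .
    have "{p \<in> price_cube. in_box E \<sigma> 0 p} = price_cube \<inter> (\<Inter>s\<in>{0, Suc 0}. \<Inter>i\<in>{i. i < ncom E s}.
        {p \<in> price_cube. \<sigma> 0 * p 0 0 \<le> p s i} \<inter> {p \<in> price_cube. \<sigma> 0 * p s i \<le> p 0 0})"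
      using box by auto
    moreover have "closed \<dots>"
      by (intro closed_INT closed_Int ballI le clK continuous_intros)
    ultimately show ?thesis by simp
  qed
  moreover have "closed {p \<in> price_cube. p 0 0 = 1}" by (intro eq continuous_intros)
  moreover have "closed (\<Inter>s\<in>{..<m}. \<Inter>i\<in>{..<ncom E (Suc s)}. {p \<in> price_cube.
      gen_excess E s p (Suc s) i + gen_excess E (Suc s) p (Suc s) i = 0})"
    by (intro closed_INT ballI eq continuous_intros continuous_on_gen_excess)
  moreover have "closed (\<Inter>t\<in>{..m}. {p \<in> price_cube. \<delta> * young_weight E t p \<le> nominal_savings E t p})"
    by (intro closed_INT ballI le continuous_intros continuous_on_young_weight continuous_on_nominal_savings)
  moreover have "initial_PO m = {p \<in> price_cube. p 0 0 = 1} \<inter> {p \<in> price_cube. in_box E \<sigma> 0 p} \<inter>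
      (\<Inter>s\<in>{..<m}. \<Inter>i\<in>{..<ncom E (Suc s)}. {p \<in> price_cube.
        gen_excess E s p (Suc s) i + gen_excess E (Suc s) p (Suc s) i = 0}) \<inter>
      (\<Inter>t\<in>{..m}. {p \<in> price_cube. \<delta> * young_weight E t p \<le> nominal_savings E t p})"
    unfolding initial_PO_def by auto
  ultimately show ?thesis by (simp add: closed_Int)
qed

lemma initial_PO_antimono: "m \<le> n \<Longrightarrow> initial_PO n \<subseteq> initial_PO m"
  unfolding initial_PO_def by auto

text \<open>The savings criterion replaces the quantification over Pareto improvements by one
  inequality per period. The a priori bounds put every equilibrium into the cube.\<close>

lemma PO_equilibria_eq:
  assumes Cass: "generalized_Cass E \<sigma>"
  shows "PO_equilibria E \<sigma> = (\<Inter>m. initial_PO m)"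
proof (intro equalityI subsetI)
  fix p assume PO: "p \<in> PO_equilibria E \<sigma>"
  then have p: "p \<in> equilibria E \<sigma>" by (simp add: PO_equilibria_def)
  note e = equilibriumD[OF p]
  have "p \<in> price_cube"
    using price_bounds[OF e(1,2) e(3) le_SucI[OF order_refl]] e(1) by (intro mem_price_cubeI) auto
  moreover have "\<delta> * young_weight E t p \<le> nominal_savings E t p" for t
    using PO Pareto_optimal_iff[OF Cass p] by blast
  ultimately show "p \<in> (\<Inter>m. initial_PO m)" unfolding initial_PO_def using e by auto
next
  fix p assume "p \<in> (\<Inter>m. initial_PO m)"
  then have m: "p \<in> initial_PO m" for m by blast
  have P: "p \<in> price_systems E" and p00: "p 0 0 = 1" and box: "in_box E \<sigma> 0 p"
    using m[of 0] price_cube_subset unfolding initial_PO_def by auto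
  have clear: "gen_excess E t p (Suc t) i + gen_excess E (Suc t) p (Suc t) i = 0"
    if "i < ncom E (Suc t)" for t i
    using m[of "Suc t"] that unfolding initial_PO_def by auto
  have "excess_demand E t (p (t - 1)) (p t) (p (Suc t)) i = 0" if "1 \<le> t" "i < ncom E t" for t i
  proof -
    obtain u where "t = Suc u" using \<open>1 \<le> t\<close> by (cases t) auto
    then show ?thesis using clear that excess_demand_Suc[of E u p i] by simp
  qed
  then have p: "p \<in> equilibria E \<sigma>"
    using P p00 box by (simp add: equilibria_def price_systems_def in_box_def)
  have "\<delta> * young_weight E t p \<le> nominal_savings E t p" for t
    using m[of t] unfolding initial_PO_def by auto
  then show "p \<in> PO_equilibria E \<sigma>" using Pareto_optimal_iff[OF Cass p] by blast
qed

lemma initial_PO_nonempty: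
  assumes s0: "0 < s0" "\<And>t. s0 \<le> \<sigma> t" and L: "\<And>t. ncom E t \<le> L"
  shows "initial_PO m \<noteq> {}"
proof -
  \<comment> \<open>In period \<open>Suc T\<close> each price is at least \<open>s0 * p T 0\<close>,
    and there are at most \<open>L\<close> of them, each at most \<open>p T 0 / s0\<close>. So each
    is at least the fraction \<open>c\<close> of their sum.\<close>
  define c where "c = s0\<^sup>2 / real L"
  have L0: "0 < real L" using L[of 0] ncom_pos[of 0] by simp
  have c: "0 < c" using s0 L0 by (simp add: c_def)
  \<comment> \<open>Between a period up to \<open>m\<close> and \<open>Suc T\<close> lie at least
    \<open>N\<close> steps, enough for geometric growth to exceed
    \<open>\<delta> / c\<close>.\<close>
  obtain N where N: "\<delta> / c < (1 + \<epsilon>) ^ N" using real_arch_pow[of "1 + \<epsilon>" "\<delta> / c"] eps by auto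
  define T where "T = m + N"
  obtain p where P: "p \<in> price_systems E" and p00: "p 0 0 = 1" and box: "\<And>t. t \<le> T \<Longrightarrow> in_box E \<sigma> t p"
    and clear: "\<And>s i. s < T \<Longrightarrow> i < ncom E (Suc s) \<Longrightarrow>
       gen_excess E s p (Suc s) i + gen_excess E (Suc s) p (Suc s) i = 0"
    and S: "nominal_savings E T p = (\<Sum>i<ncom E (Suc T). p (Suc T) i * gen_resources E (Suc T) (Suc T) i)"
    and one: "\<And>s i. Suc T < s \<Longrightarrow> i < ncom E s \<Longrightarrow> p s i = 1"
    using truncated_equilibrium[of T] by blast
  have const: "nominal_savings E t p = nominal_savings E 0 p" if "t \<le> T" for t
    using that
  proof (induction t)
    case (Suc t)
    then show ?case using nominal_savings_Suc[OF P, of t] clear[of t] by simp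
  qed simp
  have "p \<in> price_cube"
  proof (rule mem_price_cubeI[OF P])
    fix s i assume i: "i < ncom E s"
    show "lower (Suc s) \<le> p s i \<and> lower (Suc s) * p s i \<le> 1"
    proof (cases "s \<le> Suc T")
      case True
      then show ?thesis using price_bounds[OF P p00 box True i] by blast
    next
      case False
      then show ?thesis using one[of s i] i lower_antimono[of 0 "Suc s"] by (simp add: lower_0)
    qed
  qed
  moreover have "\<delta> * young_weight E t p \<le> nominal_savings E t p" if t: "t \<le> m" for t
  proof (rule ccontr)
    assume "\<not> ?thesis"
    then have lt: "nominal_savings E t p < \<delta> * young_weight E t p" by simp
    define n where "n = Suc T - t"
    have n: "t + n = Suc T" "N \<le> n" using t by (auto simp: n_def T_def)
    have "(1 + \<epsilon>) ^ n * young_weight E t p \<le> young_weight E (t + n) p"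
    proof (rule young_weight_geometric[OF P])
      show "in_box E \<sigma> (t + k) p" if "k < n" for k using box[of "t + k"] that n(1) by simp
      show "nominal_savings E (t + k) p = nominal_savings E t p" if "k < n" for k
        using const[of "t + k"] const[of t] that n(1) by simp
    qed (use lt in simp)
    then have geo: "(1 + \<epsilon>) ^ n * young_weight E t p \<le> young_weight E (Suc T) p" by (simp add: n(1))
    have bT: "s0 * p T 0 \<le> p (Suc T) i" "s0 * p (Suc T) i \<le> p T 0" if i: "i < ncom E (Suc T)" for i
    proof -
      have "\<sigma> T * p T 0 \<le> p (Suc T) i" "\<sigma> T * p (Suc T) i \<le> p T 0"
        using box[OF order_refl] i in_box_iff[of p E T \<sigma>, OF P ncom_pos sigma_pos] by auto
      moreover have "s0 * p T 0 \<le> \<sigma> T * p T 0" "s0 * p (Suc T) i \<le> \<sigma> T * p (Suc T) i"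
        using s0(2)[of T] price_systemsD(2)[OF P ncom_pos, of T] price_systemsD(2)[OF P i]
        by (auto intro: mult_right_mono less_imp_le)
      ultimately show "s0 * p T 0 \<le> p (Suc T) i" "s0 * p (Suc T) i \<le> p T 0" by auto
    qed
    have cp: "c * norm1 (ncom E (Suc T)) (p (Suc T)) \<le> p (Suc T) i" if i: "i < ncom E (Suc T)" for i
    proof -
      have "norm1 (ncom E (Suc T)) (p (Suc T)) = (\<Sum>i<ncom E (Suc T). p (Suc T) i)"
        using price_systemsD(2)[OF P] by (intro norm1_nonneg_eq) (auto intro: less_imp_le)
      then have "s0 * norm1 (ncom E (Suc T)) (p (Suc T)) = (\<Sum>i<ncom E (Suc T). s0 * p (Suc T) i)"
        by (simp add: sum_distrib_left)
      also have "\<dots> \<le> (\<Sum>i<ncom E (Suc T). p T 0)" using bT(2) by (intro sum_mono) auto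
      also have "\<dots> = real (ncom E (Suc T)) * p T 0" by simp
      also have "\<dots> \<le> real L * p T 0"
        using L[of "Suc T"] price_systemsD(2)[OF P ncom_pos, of T] by (intro mult_right_mono) auto
      finally have "s0 * (s0 * norm1 (ncom E (Suc T)) (p (Suc T))) \<le> s0 * (real L * p T 0)"
        using s0(1) by (intro mult_left_mono) auto
      also have "\<dots> = real L * (s0 * p T 0)" by simp
      also have "\<dots> \<le> real L * p (Suc T) i"
        using bT(1)[OF i] L0 by (intro mult_left_mono) auto
      finally show ?thesis using L0 by (simp add: c_def power2_eq_square field_simps)
    qed
    \<comment> \<open>Savings in period \<open>T\<close> equal the value of the endowment handed to
      the additional household, hence at least \<open>c\<close> times the last weight. Geometric
      growth from \<open>t\<close> on then makes savings exceed
      \<open>\<delta> * young_weight E t p\<close>.\<close>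
    have "c * young_weight E (Suc T) p =
        (\<Sum>i<ncom E (Suc T). (c * norm1 (ncom E (Suc T)) (p (Suc T))) * gen_resources E (Suc T) (Suc T) i)"
      by (simp add: young_weight_def gen_endow_eq sum_distrib_left mult.assoc)
    also have "\<dots> \<le> nominal_savings E T p"
      unfolding S using cp gen_resources_nonneg by (intro sum_mono mult_right_mono) auto
    also have "\<dots> = nominal_savings E t p" using const[of t] const[of T] t by (simp add: T_def)
    finally have "c * young_weight E (Suc T) p \<le> nominal_savings E t p" .
    moreover have "c * ((1 + \<epsilon>) ^ n * young_weight E t p) \<le> c * young_weight E (Suc T) p"
      using geo c by (intro mult_left_mono) auto
    ultimately have "(c * (1 + \<epsilon>) ^ n) * young_weight E t p < \<delta> * young_weight E t p"
      using lt by (simp add: mult.assoc)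
    then have "c * (1 + \<epsilon>) ^ n < \<delta>" using young_weight_pos[OF P, of t] by simp
    moreover have "c * (1 + \<epsilon>) ^ N \<le> c * (1 + \<epsilon>) ^ n"
      using n(2) eps c by (intro mult_left_mono power_increasing) auto
    moreover have "\<delta> < c * (1 + \<epsilon>) ^ N" using N c by (simp add: field_simps)
    ultimately show False by linarith
  qed
  ultimately have "p \<in> initial_PO m"
    unfolding initial_PO_def using p00 box[of 0] clear by (auto simp: T_def)
  then show ?thesis by blast
qed

end

theorem theorem5:
  fixes E :: economy and amin amax \<epsilon> \<delta> :: real and \<sigma> :: "nat \<Rightarrow> real"
  assumes "olg_economy E"
    and "bounded_growth E amin amax"
    and "\<forall>j. \<forall>h\<in>early_households E j. \<forall>h'\<in>early_households E j.
           h \<noteq> h' \<longrightarrow> indirectly_resource_related E j h h'"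
    and "unbounded_border_demand E (beta amin amax) \<sigma>"
    and "generalized_Cass E \<sigma>"
    and "\<epsilon> > 0" and "\<delta> > 0" and "prone_to_savings E \<sigma> \<epsilon> \<delta>"
    and "(INF t. \<sigma> t) > 0" and "bdd_above (range (ncom E))"
  shows "PO_equilibria E \<sigma> \<noteq> {} \<and> compact (PO_equilibria E \<sigma>) \<and>
    (\<forall>p\<in>PO_equilibria E \<sigma>.
       (\<Sum>h\<in>gen E 0. savings E 0 h (p 0) (p 1)) / gen_endow E 0 0 > \<delta>)"
proof -
  interpret prone_olg E amin amax \<epsilon> \<delta> \<sigma>
    by unfold_locales (fact assms)+
  note eq = PO_equilibria_eq[OF \<open>generalized_Cass E \<sigma>\<close>]
  obtain L where L: "\<And>t. ncom E t \<le> L" using assms(10) by (auto simp: bdd_above_def)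
  have "bdd_below (range \<sigma>)" using sigma_pos by (auto intro!: bdd_belowI[of _ 0] less_imp_le)
  then have inf: "(INF t. \<sigma> t) \<le> \<sigma> t" for t by (intro cINF_lower) auto
  have "\<exists>p. p \<in> initial_PO m" for m using initial_PO_nonempty[OF assms(9) inf L, of m] by blast
  then obtain q where q: "\<And>m. q m \<in> initial_PO m" by metis
  then have "\<forall>m. q m \<in> price_cube" by (simp add: initial_PO_def)
  then obtain p r where r: "strict_mono (r :: nat \<Rightarrow> nat)" and lim: "(q \<circ> r) \<longlonglongrightarrow> p"
    using compact_imp_seq_compact[OF compact_price_cube] seq_compactE by metis
  \<comment> \<open>Since \<open>r k \<ge> k\<close> and the sets are nested, all late terms lie in
    \<open>initial_PO m\<close>, and so does their limit.\<close>
  have "p \<in> initial_PO m" for m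
  proof (rule Lim_in_closed_set[OF closed_initial_PO _ _ lim])
    have "(q \<circ> r) k \<in> initial_PO m" if "m \<le> k" for k
      using initial_PO_antimono[of m "r k"] q[of "r k"] seq_suble[OF r, of k] that by auto
    then show "\<forall>\<^sub>F k in sequentially. (q \<circ> r) k \<in> initial_PO m"
      by (rule eventually_sequentiallyI)
  qed simp
  then have "PO_equilibria E \<sigma> \<noteq> {}" unfolding eq by blast
  moreover have "compact (PO_equilibria E \<sigma>)"
  proof -
    have "closed (\<Inter>m. initial_PO m)" by (intro closed_INT ballI closed_initial_PO)
    moreover have "(\<Inter>m. initial_PO m) = price_cube \<inter> (\<Inter>m. initial_PO m)"
      by (auto simp: initial_PO_def)
    ultimately show ?thesis unfolding eq using compact_Int_closed[OF compact_price_cube] by metis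
  qed
  moreover have "(\<Sum>h\<in>gen E 0. savings E 0 h (p 0) (p 1)) / gen_endow E 0 0 > \<delta>"
    if PO: "p \<in> PO_equilibria E \<sigma>" for p
  proof -
    have p: "p \<in> equilibria E \<sigma>" using PO by (simp add: PO_equilibria_def)
    then show ?thesis
      using PO Pareto_optimal_iff[OF assms(5) p] by (intro savings_gt_delta) auto
  qed
  ultimately show ?thesis by blast
qed

end
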